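(* Let $\mathcal{F}$ be a non-degenerate pencil of conics in $\mathbb{C}P^2$ with double points $R,S,T$, and let $\Gamma_1,\Gamma_2,\Gamma_3,\Gamma_4$ be four pairwise distinct conics in $\mathcal{F}$. Let $d$ be a straight line containing none of $R,S,T$. Denote by $\mathcal{C}$ the conic which is the image of $d$ under conjugation with respect to $\mathcal{F}$, and denote by $P_i$ the pole of $d$ with respect to $\Gamma_i$ ($i=1,2,3,4$). Then $$(\Gamma_1,\Gamma_2,\Gamma_3,\Gamma_4)=(P_1,P_2,P_3,P_4)_{\mathcal{C}}.$$
   Context: We work in $\mathbb{C}P^2$. A conic is the zero set of a non-zero quadratic form on $\mathbb{C}^3$ (up to scalar), possibly degenerate; it is identified with a point of $\mathbb{P}(Q(\mathbb{C}^3))$, where $Q(\mathbb{C}^3)$ is the space of quadratic forms. A pencil of conics is a projective line in $\mathbb{P}(Q(\mathbb{C}^3))$. It is non-degenerate if it consists of all conics through four distinct points, no three collinear (its base points). It then contains exactly three degenerate conics, each a pair of lines through the base points; the intersection point of the two lines of such a pair is called a double point of the pencil, so there are three double points $R,S,T$. The cross ratio of four distinct points on a projective line, in terms of an affine coordinate, is $(A,B,C,D)=\frac{(A-C)(B-D)}{(B-C)(A-D)}$. The cross ratio of four concurrent lines is their cross ratio as points of a line in the dual projective plane (equivalently, the cross ratio of their intersection points with any line not through the common point). The cross ratio $(\Gamma_1,\Gamma_2,\Gamma_3,\Gamma_4)$ of four conics in a pencil is their cross ratio as points of the projective line in $\mathbb{P}(Q(\mathbb{C}^3))$ which is the pencil.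 For four points $A,B,C,D$ on a non-degenerate conic $\mathcal{C}$, $(A,B,C,D)_{\mathcal{C}}$ is the cross ratio of the lines $(PA,PB,PC,PD)$ for any other point $P\in\mathcal{C}$ (it is independent of $P$). The polar of a point $P$ with respect to a conic with quadratic form $q$ and associated bilinear form $b$ is the line $\{Q: b(P,Q)=0\}$. The pole of a line $d$ with respect to a conic $\Gamma$ is the common point of the polars with respect to $\Gamma$ of the points of $d$ (if $\Gamma$ is non-degenerate, it is the unique point whose polar is $d$). For a point $P$ which is not a double point of $\mathcal{F}$, the polars of $P$ with respect to the conics in $\mathcal{F}$ are concurrent in a single point $P'$, called the conjugated point of $P$ with respect to $\mathcal{F}$; the map $P\mapsto P'$ is called conjugation with respect to $\mathcal{F}$. The point-wise image under conjugation of a line containing no double point is a non-degenerate conic through $R,S,T$, which is also the set of all poles of that line with respect to the conics of $\mathcal{F}$. *)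

theory Defs
  imports "HOL-Analysis.Analysis" "HOL-Library.Function_Algebras"
begin

section \<open>Projective geometry of a vector space\<close>

text \<open>A projective point is a one-dimensional subspace of the ambient vector space; projective
  lines are sets of projective points.\<close>

context vector_space
begin

definition proj_points :: "'b set \<Rightarrow> 'b set set" where
  "proj_points V = {span {v} | v. v \<in> V \<and> v \<noteq> 0}"

definition proj_line :: "'b set \<Rightarrow> 'b set set \<Rightarrow> bool" where
  "proj_line V L \<longleftrightarrow>
     (\<exists>u\<in>V. \<exists>v\<in>V. u \<noteq> v \<and> independent {u, v} \<and> L = local.proj_points (span {u, v}))"

text \<open>On the projective line spanned by independent \<open>u\<close> and \<open>v\<close>, the point spanned by \<open>u + t v\<close>
  has affine coordinate \<open>t\<close>, the point spanned by \<open>v\<close> being at infinity. Over an infinite field,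
  \<open>u\<close> and \<open>v\<close> can be chosen such that none of four given points is at infinity.\<close>

definition cross_ratio :: "'b set \<Rightarrow> 'b set \<Rightarrow> 'b set \<Rightarrow> 'b set \<Rightarrow> 'a" where
  "cross_ratio A B C D = (THE k. \<exists>u v a b c d. u \<noteq> v \<and> independent {u, v} \<and>
     A = span {u + scale a v} \<and> B = span {u + scale b v} \<and>
     C = span {u + scale c v} \<and> D = span {u + scale d v} \<and>
     k = ((a - c) * (b - d)) / ((b - c) * (a - d)))"

end

text \<open>Quadratic forms and linear forms are vectors of a space of functions.\<close>

interpretation fn: vector_space "\<lambda>(c :: 'a :: field) (f :: 'x \<Rightarrow> 'a) x. c * f x"
  by unfold_locales (auto simp: fun_eq_iff algebra_simps)


section \<open>The complex projective plane\<close>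

type_synonym cpoint = "(complex ^ 3) set"
type_synonym conic = "(complex ^ 3 \<Rightarrow> complex) set"

definition CP2 :: "cpoint set" where
  "CP2 = vec.proj_points UNIV"

definition line :: "cpoint set \<Rightarrow> bool" where
  "line l \<longleftrightarrow> vec.proj_line UNIV l"

definition join :: "cpoint \<Rightarrow> cpoint \<Rightarrow> cpoint set" where
  "join P Q = vec.proj_points (vec.span (P \<union> Q))"

definition collinear_points :: "cpoint \<Rightarrow> cpoint \<Rightarrow> cpoint \<Rightarrow> bool" where
  "collinear_points A B C \<longleftrightarrow> (\<exists>l. line l \<and> A \<in> l \<and> B \<in> l \<and> C \<in> l)"

definition linear_form :: "(complex ^ 3 \<Rightarrow> complex) \<Rightarrow> bool" where
  "linear_form \<phi> \<longleftrightarrow> Vector_Spaces.linear (*s) (*) \<phi>"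

text \<open>The linear forms vanishing on a line constitute a point of the dual plane.\<close>

definition dual_point :: "cpoint set \<Rightarrow> (complex ^ 3 \<Rightarrow> complex) set" where
  "dual_point l = {\<phi>. linear_form \<phi> \<and> (\<forall>P\<in>l. \<forall>x\<in>P. \<phi> x = 0)}"

definition line_cross_ratio ::
    "cpoint set \<Rightarrow> cpoint set \<Rightarrow> cpoint set \<Rightarrow> cpoint set \<Rightarrow> complex" where
  "line_cross_ratio k l m n =
     fn.cross_ratio (dual_point k) (dual_point l) (dual_point m) (dual_point n)"


section \<open>Conics\<close>

definition symmetric_bilinear :: "(complex ^ 3 \<Rightarrow> complex ^ 3 \<Rightarrow> complex) \<Rightarrow> bool" where
  "symmetric_bilinear b \<longleftrightarrow> (\<forall>x y. b x y = b y x) \<and> (\<forall>x. linear_form (b x))"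

definition quadratic_forms :: "(complex ^ 3 \<Rightarrow> complex) set" where
  "quadratic_forms = {q. \<exists>b. symmetric_bilinear b \<and> q = (\<lambda>x. b x x)}"

text \<open>Polarization recovers the symmetric bilinear form from its quadratic form.\<close>

definition bilinear_form_of ::
    "(complex ^ 3 \<Rightarrow> complex) \<Rightarrow> complex ^ 3 \<Rightarrow> complex ^ 3 \<Rightarrow> complex" where
  "bilinear_form_of q x y = (q (x + y) - q x - q y) / 2"

definition conics :: "conic set" where
  "conics = fn.proj_points quadratic_forms"

text \<open>A conic consists of the scalar multiples of one quadratic form, so quantifying over all
  its elements, and over all representatives of points, expresses the vanishing of that form.\<close>

definition zero_set :: "conic \<Rightarrow> cpoint set" where
  "zero_set \<Gamma> = {P \<in> CP2. \<forall>q\<in>\<Gamma>. \<forall>x\<in>P. q x = 0}"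

definition polar :: "conic \<Rightarrow> cpoint \<Rightarrow> cpoint set" where
  "polar \<Gamma> P = {Q \<in> CP2. \<forall>q\<in>\<Gamma>. \<forall>x\<in>P. \<forall>y\<in>Q. bilinear_form_of q x y = 0}"

definition pole :: "conic \<Rightarrow> cpoint set \<Rightarrow> cpoint" where
  "pole \<Gamma> d = (THE P. P \<in> CP2 \<and> (\<forall>Q\<in>d. P \<in> polar \<Gamma> Q))"

definition conic_cross_ratio ::
    "conic \<Rightarrow> cpoint \<Rightarrow> cpoint \<Rightarrow> cpoint \<Rightarrow> cpoint \<Rightarrow> complex" where
  "conic_cross_ratio \<C> A B C D = (THE k. \<forall>P \<in> zero_set \<C> - {A, B, C, D}.
     line_cross_ratio (join P A) (join P B) (join P C) (join P D) = k)"


section \<open>Pencils of conics\<close>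

definition pencil :: "conic set \<Rightarrow> bool" where
  "pencil F \<longleftrightarrow> fn.proj_line quadratic_forms F"

definition nondegenerate_pencil :: "conic set \<Rightarrow> bool" where
  "nondegenerate_pencil F \<longleftrightarrow> pencil F \<and>
     (\<exists>A B C D. {A, B, C, D} \<subseteq> CP2 \<and> distinct [A, B, C, D] \<and>
        \<not> collinear_points A B C \<and> \<not> collinear_points A B D \<and>
        \<not> collinear_points A C D \<and> \<not> collinear_points B C D \<and>
        F = {\<Gamma> \<in> conics. {A, B, C, D} \<subseteq> zero_set \<Gamma>})"

definition double_points :: "conic set \<Rightarrow> cpoint set" where
  "double_points F = {P. \<exists>\<Gamma>\<in>F. \<exists>l m. line l \<and> line m \<and> l \<noteq> m \<and>
     zero_set \<Gamma> = l \<union> m \<and> P \<in> l \<inter> m}"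

definition conjugate_point :: "conic set \<Rightarrow> cpoint \<Rightarrow> cpoint" where
  "conjugate_point F P = (THE P'. P' \<in> CP2 \<and> (\<forall>\<Gamma>\<in>F. P' \<in> polar \<Gamma> P))"

definition conjugate_conic :: "conic set \<Rightarrow> cpoint set \<Rightarrow> conic" where
  "conjugate_conic F d = (THE \<C>. \<C> \<in> conics \<and> zero_set \<C> = conjugate_point F ` d)"

end

theory Submission
  imports Defs
begin

text \<open>Take the double points as coordinate frame and scale it such that the base points are
  \<open>(\<plusminus>1, \<plusminus>1, 1)\<close>. The pencil then consists of the forms \<open>a x\<^sup>2 + b y\<^sup>2 + c z\<^sup>2\<close> with
  \<open>a + b + c = 0\<close>, conjugation inverts the coordinates, and the pole of
  \<open>\<alpha> x + \<beta> y + \<gamma> z = 0\<close> is \<open>(\<alpha> / a, \<beta> / b, \<gamma> / c)\<close>. Every point of the conic \<open>\<C>\<close> is such a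
  pole, say with parameters \<open>s + t + u = 0\<close>, and the line joining it to the pole with parameters
  \<open>a, b, c\<close> has the equation \<open>(a s / \<alpha>) x + (b t / \<beta>) y + (c u / \<gamma>) z = 0\<close>. So the lines joining a
  fixed point of \<open>\<C>\<close> to the poles depend linearly on the conics of the pencil, and cross ratios
  are preserved.\<close>

section \<open>Pairs of vectors, and the cross ratio in homogeneous coordinates\<close>

context vector_space
begin

lemma independent_pair_iff:
  "u \<noteq> v \<and> independent {u, v} \<longleftrightarrow> (\<forall>a b. scale a u + scale b v = 0 \<longrightarrow> a = 0 \<and> b = 0)"
  (is "?L \<longleftrightarrow> ?R")
proof
  assume L: ?L
  have *: "u \<notin> span {v}" "v \<noteq> 0"
    using L independent_insert[of u "{v}"] independent_insert[of v "{}"]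
    by (auto dest: dependent_zero)
  show ?R
  proof (intro allI impI)
    fix a b assume e: "scale a u + scale b v = 0"
    have "a = 0"
    proof (rule ccontr)
      assume a: "a \<noteq> 0"
      have "scale a u = scale (- b) v" using e by (simp add: eq_neg_iff_add_eq_0)
      then have "scale (inverse a) (scale a u) = scale (inverse a) (scale (- b) v)" by simp
      then have "u = scale (inverse a * - b) v" using a by simp
      then show False using * by (metis span_base span_scale singletonI)
    qed
    with e * show "a = 0 \<and> b = 0" by simp
  qed
next
  assume R: ?R
  have v: "v \<noteq> 0" using R[rule_format, of 0 1] by auto
  have u: "u \<notin> span {v}"
  proof
    assume "u \<in> span {v}"
    then obtain k where "u = scale k v" by (auto simp: span_singleton)
    then show False using R[rule_format, of 1 "- k"] by auto
  qed
  then have "u \<noteq> v" by (auto simp: span_base)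
  with u v show ?L by (auto simp: independent_insert)
qed

lemma span_pair: "span {u, v} = {scale a u + scale b v | a b. True}"
proof (intro set_eqI iffI)
  fix x assume "x \<in> span {u, v}"
  then obtain k where "x - scale k u \<in> span {v}" by (auto simp: span_insert)
  then obtain l where "x - scale k u = scale l v" by (auto simp: span_singleton)
  then have "x = scale k u + scale l v" by (simp add: algebra_simps)
  then show "x \<in> {scale a u + scale b v | a b. True}" by blast
next
  fix x assume "x \<in> {scale a u + scale b v | a b. True}"
  then obtain a b where "x = scale a u + scale b v" by blast
  moreover have "scale a u + scale b v \<in> span {u, v}"
    by (intro span_add span_scale span_base) auto
  ultimately show "x \<in> span {u, v}" by simp
qed

lemma span_singleton_eq_iff: "span {u} = span {v} \<longleftrightarrow> (\<exists>k. k \<noteq> 0 \<and> u = scale k v)"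
proof
  assume e: "span {u} = span {v}"
  then have "u \<in> span {v}" "v \<in> span {u}" by (metis span_base singletonI)+
  then obtain k l where k: "u = scale k v" and l: "v = scale l u"
    unfolding span_singleton by blast
  show "\<exists>k. k \<noteq> 0 \<and> u = scale k v"
  proof (cases "k = 0")
    case True
    then show ?thesis using k l by (intro exI[of _ 1]) auto
  next
    case False
    then show ?thesis using k by blast
  qed
next
  assume "\<exists>k. k \<noteq> 0 \<and> u = scale k v"
  then show "span {u} = span {v}"
    by (auto simp: span_image_scale[of "{v}" "\<lambda>_. _", simplified] intro: span_image_scale)
qed

lemma independent_pair_of_span_neq:
  assumes "u \<noteq> 0" "v \<noteq> 0" "span {u} \<noteq> span {v}"
  shows "u \<noteq> v \<and> independent {u, v}"
proof -
  have "u \<notin> span {v}"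
  proof
    assume "u \<in> span {v}"
    then obtain k where "u = scale k v" by (auto simp: span_singleton)
    then show False using assms span_singleton_eq_iff[of u v] by (cases "k = 0") auto
  qed
  then show ?thesis using assms(2) by (auto simp: independent_insert span_base)
qed

text \<open>By independence, the two vectors are proportional exactly when their coefficient pairs
  are, which the determinant detects.\<close>

lemma span_neq_iff_det:
  assumes "u \<noteq> v \<and> independent {u, v}" "(a, a') \<noteq> (0, 0)" "(b, b') \<noteq> (0, 0)"
  shows "span {scale a u + scale a' v} \<noteq> span {scale b u + scale b' v} \<longleftrightarrow> a * b' - a' * b \<noteq> 0"
proof -
  have eq: "scale a u + scale a' v = scale k (scale b u + scale b' v) \<longleftrightarrow> a = k * b \<and> a' = k * b'" for k
  proof
    assume "scale a u + scale a' v = scale k (scale b u + scale b' v)"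
    then have "scale (a - k * b) u + scale (a' - k * b') v = 0"
      by (simp add: algebra_simps)
    then show "a = k * b \<and> a' = k * b'"
      using assms(1) unfolding independent_pair_iff by fastforce
  qed (simp add: scale_right_distrib)
  show ?thesis
    unfolding span_singleton_eq_iff eq
  proof (intro iffI notI)
    assume "\<nexists>k. k \<noteq> 0 \<and> a = k * b \<and> a' = k * b'" and det: "a * b' - a' * b = 0"
    moreover have "a = (a / b) * b \<and> a' = (a / b) * b'" if "b \<noteq> 0"
      using that det by (simp add: field_simps)
    moreover have "a = (a' / b') * b \<and> a' = (a' / b') * b'" if "b' \<noteq> 0"
      using that det by (simp add: field_simps)
    ultimately show False using assms(2,3)
      by (metis mult_zero_left)
  qed (auto simp: algebra_simps)
qed

text \<open>The defining formula wants four finite points, whereas here a point may be at infinity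
  in the given basis. For existence, the basis is changed so that all four become finite; for
  uniqueness, any other admissible basis changes the determinants only by factors that
  cancel.\<close>

lemma cross_ratio_homogeneous:
  assumes uv: "u \<noteq> v \<and> independent {u, v}" and inf: "infinite (UNIV :: 'a set)"
    and nz: "a * b' - a' * b \<noteq> 0" "a * c' - a' * c \<noteq> 0" "b * c' - b' * c \<noteq> 0"
      "a * d' - a' * d \<noteq> 0" "b * d' - b' * d \<noteq> 0"
  shows "cross_ratio (span {scale a u + scale a' v}) (span {scale b u + scale b' v})
           (span {scale c u + scale c' v}) (span {scale d u + scale d' v})
         = ((a * c' - a' * c) * (b * d' - b' * d)) / ((b * c' - b' * c) * (a * d' - a' * d))"
    (is "cross_ratio ?A ?B ?C ?D = ?k")
  unfolding cross_ratio_def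
proof (rule the_equality)
  \<comment> \<open>In the basis \<open>u\<close>, \<open>s u + v\<close>, the vector
    \<open>x u + x' v\<close> has first coefficient \<open>x - s x'\<close>, which must not vanish.
    For \<open>x' \<noteq> 0\<close> this excludes \<open>s = x / x'\<close>; for
    \<open>x' = 0\<close> the coefficient is \<open>x\<close>, non-zero for every
    \<open>s\<close>.\<close>
  obtain s where s: "s \<notin> {a / a', b / b', c / c', d / d'}"
    using ex_new_if_finite[OF inf, of "{a / a', b / b', c / c', d / d'}"] by auto
  have *: "x - s * x' \<noteq> 0" if "s \<noteq> x / x'" "(x, x') \<noteq> (0, 0)" for x x'
    using that by (cases "x' = 0") (auto simp: field_simps)
  have nzs: "a - s * a' \<noteq> 0" "b - s * b' \<noteq> 0" "c - s * c' \<noteq> 0" "d - s * d' \<noteq> 0"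
    by (intro *; use s nz in force)+
  let ?v = "scale s u + v"
  have ind: "u \<noteq> ?v \<and> independent {u, ?v}"
    unfolding independent_pair_iff
  proof (intro allI impI)
    fix x y assume "scale x u + scale y ?v = 0"
    then have "scale (x + y * s) u + scale y v = 0" by (simp add: algebra_simps)
    then show "x = 0 \<and> y = 0" using uv unfolding independent_pair_iff by fastforce
  qed
  have sp: "span {scale x u + scale x' v} = span {u + scale (x' / (x - s * x')) ?v}"
    if "x - s * x' \<noteq> 0" for x x'
    unfolding span_singleton_eq_iff
  proof (intro exI conjI)
    have "scale (x - s * x') (u + scale (x' / (x - s * x')) ?v) = scale (x - s * x') u + scale x' ?v"
      using that by (simp add: scale_right_distrib)
    also have "\<dots> = scale x u + scale x' v" by (simp add: algebra_simps)
    finally show "scale x u + scale x' v = scale (x - s * x') (u + scale (x' / (x - s * x')) ?v)" ..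
  qed fact
  \<comment> \<open>Differences of the new affine coordinates are the old determinants up to sign
    and denominators, and these cancel in the cross ratio by \<open>cancel\<close>.\<close>
  have df: "x' / (x - s * x') - y' / (y - s * y') = - (x * y' - x' * y) / ((x - s * x') * (y - s * y'))"
    if "x - s * x' \<noteq> 0" "y - s * y' \<noteq> 0" for x x' y y'
    using that by (simp add: divide_simps) (simp add: algebra_simps)
  have cancel: "(x * y) / (z * w) = ((- x / (p * r)) * (- y / (q * t))) / ((- z / (q * r)) * (- w / (p * t)))"
    if "p \<noteq> 0" "q \<noteq> 0" "r \<noteq> 0" "t \<noteq> 0" for x y z w p q r t :: 'a
    using that by (simp add: divide_simps)
  show "\<exists>u v a b c d. u \<noteq> v \<and> independent {u, v} \<and>
     ?A = span {u + scale a v} \<and> ?B = span {u + scale b v} \<and>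
     ?C = span {u + scale c v} \<and> ?D = span {u + scale d v} \<and>
     ?k = ((a - c) * (b - d)) / ((b - c) * (a - d))"
    apply (rule exI[of _ u], rule exI[of _ ?v], rule exI[of _ "a' / (a - s * a')"],
        rule exI[of _ "b' / (b - s * b')"], rule exI[of _ "c' / (c - s * c')"],
        rule exI[of _ "d' / (d - s * d')"])
    unfolding df[OF nzs(1,3)] df[OF nzs(2,4)] df[OF nzs(2,3)] df[OF nzs(1,4)]
    using ind sp[OF nzs(1)] sp[OF nzs(2)] sp[OF nzs(3)] sp[OF nzs(4)] cancel[OF nzs] by blast
next
  fix k assume "\<exists>u v a b c d. u \<noteq> v \<and> independent {u, v} \<and>
     ?A = span {u + scale a v} \<and> ?B = span {u + scale b v} \<and>
     ?C = span {u + scale c v} \<and> ?D = span {u + scale d v} \<and>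
     k = ((a - c) * (b - d)) / ((b - c) * (a - d))"
  then obtain U V x y z w where UV: "U \<noteq> V \<and> independent {U, V}"
    and sp: "span {U + scale x V} = ?A" "span {U + scale y V} = ?B"
      "span {U + scale z V} = ?C" "span {U + scale w V} = ?D"
    and k: "k = ((x - z) * (y - w)) / ((y - z) * (x - w))"
    by metis
  obtain l1 where l1: "l1 \<noteq> 0" "U + scale x V = scale l1 (scale a u + scale a' v)"
    using sp(1) unfolding span_singleton_eq_iff by blast
  obtain l2 where l2: "l2 \<noteq> 0" "U + scale y V = scale l2 (scale b u + scale b' v)"
    using sp(2) unfolding span_singleton_eq_iff by blast
  obtain l3 where l3: "l3 \<noteq> 0" "U + scale z V = scale l3 (scale c u + scale c' v)"
    using sp(3) unfolding span_singleton_eq_iff by blast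
  obtain l4 where l4: "l4 \<noteq> 0" "U + scale w V = scale l4 (scale d u + scale d' v)"
    using sp(4) unfolding span_singleton_eq_iff by blast
  note l = l1(1) l2(1) l3(1) l4(1) and e = l1(2) l2(2) l3(2) l4(2)
  have AB: "?A \<noteq> ?B" using nz by (subst span_neq_iff_det[OF uv]) auto
  then have xy: "x \<noteq> y" using sp by auto
  \<comment> \<open>Subtracting the representatives of two distinct points eliminates
    \<open>U\<close>, so that \<open>V\<close>, and then \<open>U\<close>, can be expressed in
    \<open>u\<close> and \<open>v\<close>.\<close>
  have V: "scale (x - y) V = scale (l1 * a - l2 * b) u + scale (l1 * a' - l2 * b') v"
  proof -
    have "scale (x - y) V = (U + scale x V) - (U + scale y V)" by (simp add: algebra_simps)
    then show ?thesis unfolding e by (simp add: algebra_simps)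
  qed
  define r t where "r = (l1 * a - l2 * b) / (x - y)" and "t = (l1 * a' - l2 * b') / (x - y)"
  have "V = scale (1 / (x - y)) (scale (x - y) V)" using xy by simp
  also have "\<dots> = scale r u + scale t v" unfolding V r_def t_def by (simp add: scale_right_distrib)
  finally have V: "V = scale r u + scale t v" .
  define p q where "p = l1 * a - x * r" and "q = l1 * a' - x * t"
  have "U = (U + scale x V) - scale x V" by simp
  also have "\<dots> = scale l1 (scale a u + scale a' v) - scale x (scale r u + scale t v)"
    unfolding l1(2)[symmetric] V ..
  also have "\<dots> = scale p u + scale q v" unfolding p_def q_def by (simp add: algebra_simps)
  finally have U: "U = scale p u + scale q v" .
  have co: "p + j * r = l * m \<and> q + j * t = l * m'"
    if "U + scale j V = scale l (scale m u + scale m' v)" for j l m m'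
  proof -
    have "scale (p + j * r - l * m) u + scale (q + j * t - l * m') v = 0"
      using that unfolding U V by (simp add: algebra_simps)
    then show ?thesis using uv unfolding independent_pair_iff by fastforce
  qed
  \<comment> \<open>The determinant of two representatives, computed in both bases:
    \<open>p t - q r\<close> is the determinant of the base change, \<open>l\<close> and
    \<open>l'\<close> are the scalars of the representatives. Each such factor occurs equally often
    in numerator and denominator of the cross ratio.\<close>
  have wedge: "(p * t - q * r) * (i - j) = - (l * l') * (m * n' - m' * n)"
    if "U + scale i V = scale l (scale m u + scale m' v)"
      "U + scale j V = scale l' (scale n u + scale n' v)" for i j l l' m m' n n'
  proof -
    have "- (l * l') * (m * n' - m' * n) = (l * m') * (l' * n) - (l * m) * (l' * n')"
      by (simp add: algebra_simps)
    also have "\<dots> = (q + i * t) * (p + j * r) - (p + i * r) * (q + j * t)"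
      using co[OF that(1)] co[OF that(2)] by simp
    also have "\<dots> = (p * t - q * r) * (i - j)" by (simp add: algebra_simps)
    finally show ?thesis by simp
  qed
  define D where "D = p * t - q * r"
  note w = wedge[OF e(1,3)] wedge[OF e(2,4)] wedge[OF e(2,3)] wedge[OF e(1,4)]
  have D: "D \<noteq> 0" using w(1) l nz by (auto simp: D_def)
  have "k = ((D * (x - z)) * (D * (y - w))) / ((D * (y - z)) * (D * (x - w)))"
  proof -
    have "(m * n) / (i * j) = ((D * m) * (D * n)) / ((D * i) * (D * j))" for m n i j
      using D by simp
    then show ?thesis unfolding k .
  qed
  also have "\<dots> = ?k"
  proof -
    have "((- (l1 * l3) * m) * (- (l2 * l4) * n)) / ((- (l2 * l3) * i) * (- (l1 * l4) * j))
        = (m * n) / (i * j)" for m n i j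
      using l by (simp add: divide_simps)
    then show ?thesis unfolding D_def w .
  qed
  finally show "k = ?k" .
qed

end

section \<open>Points, zero sets and polars in terms of representatives\<close>

lemma linear_form_iff:
  "linear_form \<phi> \<longleftrightarrow> (\<forall>x y. \<phi> (x + y) = \<phi> x + \<phi> y) \<and> (\<forall>k x. \<phi> (k *s x) = k * \<phi> x)"
  by (simp add: linear_form_def Vector_Spaces.linear_iff vec.vector_space_axioms vector_space_over_itself.vector_space_axioms)

lemma mem_CP2_iff: "P \<in> CP2 \<longleftrightarrow> (\<exists>x. x \<noteq> 0 \<and> P = vec.span {x})"
  by (auto simp: CP2_def vec.proj_points_def)

lemma span_in_CP2 [simp]: "vec.span {x} \<in> CP2 \<longleftrightarrow> x \<noteq> 0"
proof -
  have "vec.span {x} = vec.span {y} \<Longrightarrow> x = 0 \<Longrightarrow> y = 0" for y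
    using vec.span_base[of y "{y}"] by auto
  then show ?thesis unfolding mem_CP2_iff by metis
qed

lemma quadratic_form_scale:
  assumes "q \<in> quadratic_forms"
  shows "q (k *s x) = k\<^sup>2 * q x"
  using assms unfolding quadratic_forms_def symmetric_bilinear_def linear_form_iff
  by (auto simp: power2_eq_square)

text \<open>By homogeneity, rescaling the form or the vector only multiplies the value, so one
  representative of each decides.\<close>

lemma span_in_zero_set_iff:
  assumes "q \<in> quadratic_forms"
  shows "vec.span {x} \<in> zero_set (fn.span {q}) \<longleftrightarrow> x \<noteq> 0 \<and> q x = 0"
proof -
  have "(\<forall>p\<in>fn.span {q}. \<forall>y\<in>vec.span {x}. p y = 0) \<longleftrightarrow> (\<forall>c k. c * (k\<^sup>2 * q x) = 0)"
    by (auto simp: fn.span_singleton vec.span_singleton quadratic_form_scale[OF assms])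
  also have "\<dots> \<longleftrightarrow> q x = 0" by (metis mult_1 mult_zero_right power_one)
  finally show ?thesis by (simp add: zero_set_def)
qed

lemma bilinear_form_of_quadratic:
  assumes "symmetric_bilinear b"
  shows "bilinear_form_of (\<lambda>x. b x x) = b"
proof (intro ext)
  fix x y
  have add: "b z (x + y) = b z x + b z y" and sym: "b z w = b w z" for z w
    using assms unfolding symmetric_bilinear_def linear_form_iff by blast+
  have "b (x + y) (x + y) = b x x + b x y + (b x y + b y y)"
    by (simp only: add sym[of "x + y" x] sym[of "x + y" y] sym[of y x])
  then show "bilinear_form_of (\<lambda>x. b x x) x y = b x y"
    by (simp add: bilinear_form_of_def)
qed

lemma span_in_polar_iff:
  assumes b: "symmetric_bilinear b"
  shows "vec.span {y} \<in> polar (fn.span {\<lambda>x. b x x}) (vec.span {x}) \<longleftrightarrow> y \<noteq> 0 \<and> b x y = 0"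
proof -
  have sc: "b (k *s x) (l *s y) = k * l * b x y" for k l
  proof -
    have scale: "b z (m *s w) = m * b z w" and sym: "b z w = b w z" for z w m
      using b unfolding symmetric_bilinear_def linear_form_iff by blast+
    show ?thesis by (simp add: scale sym[of "k *s x"] sym[of y x])
  qed
  have fs: "bilinear_form_of (\<lambda>x. c * b x x) x y = c * b x y" for c x y
    using fun_cong[OF fun_cong[OF bilinear_form_of_quadratic[OF b]], of x y]
    by (simp add: bilinear_form_of_def algebra_simps)
  have "(\<forall>q\<in>fn.span {\<lambda>x. b x x}. \<forall>z\<in>vec.span {x}. \<forall>w\<in>vec.span {y}. bilinear_form_of q z w = 0)
      \<longleftrightarrow> (\<forall>k l m. k * (l * m * b x y) = 0)"
    by (auto simp: fn.span_singleton vec.span_singleton fs sc)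
  also have "\<dots> \<longleftrightarrow> b x y = 0" by (metis mult_1 mult_zero_right)
  finally show ?thesis by (simp add: polar_def)
qed

text \<open>The equations say that the cross product of the two triples vanishes; the factor is read
  off at a non-zero entry of the first.\<close>

lemma proportional_of_cross_zero:
  assumes "(a, b, c) \<noteq> (0, 0, 0)" "b * c' = c * b'" "c * a' = a * c'" "a * b' = b * (a' :: complex)"
  shows "\<exists>k. a' = k * a \<and> b' = k * b \<and> c' = k * c"
proof -
  consider "a \<noteq> 0" | "b \<noteq> 0" | "c \<noteq> 0" using assms(1) by auto
  then show ?thesis
  proof cases
    case 1 then show ?thesis using assms by (intro exI[of _ "a' / a"]) (simp add: field_simps)
  next
    case 2 then show ?thesis using assms by (intro exI[of _ "b' / b"]) (simp add: field_simps)
  next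
    case 3 then show ?thesis using assms by (intro exI[of _ "c' / c"]) (simp add: field_simps)
  qed
qed

section \<open>Coordinates in a basis: linear forms, lines and joins\<close>

locale frame =
  fixes e1 e2 e3 :: "complex ^ 3" and X1 X2 X3 :: "complex ^ 3 \<Rightarrow> complex"
  assumes linear_X [simp]: "linear_form X1" "linear_form X2" "linear_form X3"
    and X_e [simp]: "X1 e1 = 1" "X1 e2 = 0" "X1 e3 = 0"
      "X2 e1 = 0" "X2 e2 = 1" "X2 e3 = 0" "X3 e1 = 0" "X3 e2 = 0" "X3 e3 = 1"
    and expansion: "x = X1 x *s e1 + X2 x *s e2 + X3 x *s e3"
begin

lemma X_add [simp]: "X1 (x + y) = X1 x + X1 y" "X2 (x + y) = X2 x + X2 y" "X3 (x + y) = X3 x + X3 y"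
  and X_scale [simp]: "X1 (k *s x) = k * X1 x" "X2 (k *s x) = k * X2 x" "X3 (k *s x) = k * X3 x"
  using linear_X unfolding linear_form_iff by auto

lemma X_diff [simp]: "X1 (x - y) = X1 x - X1 y" "X2 (x - y) = X2 x - X2 y" "X3 (x - y) = X3 x - X3 y"
  using X_add[of "x - y" y] by simp_all

definition mk :: "complex \<Rightarrow> complex \<Rightarrow> complex \<Rightarrow> complex ^ 3" where
  "mk a b c = a *s e1 + b *s e2 + c *s e3"

lemma X_mk [simp]: "X1 (mk a b c) = a" "X2 (mk a b c) = b" "X3 (mk a b c) = c"
  by (simp_all add: mk_def)

lemma mk_X: "mk (X1 x) (X2 x) (X3 x) = x"
  using expansion[of x] by (simp add: mk_def)

lemma eq_iff_X: "x = y \<longleftrightarrow> X1 x = X1 y \<and> X2 x = X2 y \<and> X3 x = X3 y"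
  by (metis mk_X)

lemma X_zero [simp]: "X1 0 = 0" "X2 0 = 0" "X3 0 = 0"
  using X_scale[of 0] by auto

lemma X_minus [simp]: "X1 (- x) = - X1 x" "X2 (- x) = - X2 x" "X3 (- x) = - X3 x"
  using X_diff[of 0 x] by simp_all

lemma scale_mk [simp]: "k *s mk a b c = mk (k * a) (k * b) (k * c)"
  by (simp add: eq_iff_X)

lemma mk_eq_iff [simp]: "mk a b c = mk a' b' c' \<longleftrightarrow> a = a' \<and> b = b' \<and> c = c'"
  by (simp add: eq_iff_X)

lemma mk_eq_0_iff [simp]: "mk a b c = 0 \<longleftrightarrow> a = 0 \<and> b = 0 \<and> c = 0"
  by (simp add: eq_iff_X)

definition lf :: "complex \<Rightarrow> complex \<Rightarrow> complex \<Rightarrow> complex ^ 3 \<Rightarrow> complex" where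
  "lf a b c = (\<lambda>x. a * X1 x + b * X2 x + c * X3 x)"

lemma linear_form_iff_lf: "linear_form \<phi> \<longleftrightarrow> (\<exists>a b c. \<phi> = lf a b c)"
proof
  assume \<phi>: "linear_form \<phi>"
  have "\<phi> = lf (\<phi> e1) (\<phi> e2) (\<phi> e3)"
  proof
    fix x
    have "\<phi> x = \<phi> (X1 x *s e1 + X2 x *s e2 + X3 x *s e3)" using expansion[of x] by simp
    also have "\<dots> = lf (\<phi> e1) (\<phi> e2) (\<phi> e3) x"
      using \<phi> unfolding linear_form_iff lf_def by (simp add: mult.commute)
    finally show "\<phi> x = lf (\<phi> e1) (\<phi> e2) (\<phi> e3) x" .
  qed
  then show "\<exists>a b c. \<phi> = lf a b c" by blast
qed (auto simp: linear_form_iff lf_def algebra_simps)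

text \<open>If the cross product vanished, each \<open>Xi v *s u - Xi u *s v\<close> would be zero;
  independence would then make all coordinates of \<open>u\<close> zero, hence \<open>u\<close>
  itself.\<close>

lemma cross_nonzero:
  assumes "u \<noteq> v \<and> vec.independent {u, v}"
  shows "\<not> (X2 u * X3 v - X3 u * X2 v = 0 \<and> X3 u * X1 v - X1 u * X3 v = 0
    \<and> X1 u * X2 v - X2 u * X1 v = 0)"
proof
  assume z: "X2 u * X3 v - X3 u * X2 v = 0 \<and> X3 u * X1 v - X1 u * X3 v = 0
    \<and> X1 u * X2 v - X2 u * X1 v = 0"
  have "X1 v *s u + (- X1 u) *s v = 0" "X2 v *s u + (- X2 u) *s v = 0" "X3 v *s u + (- X3 u) *s v = 0"
    using z by (auto simp: eq_iff_X algebra_simps)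
  then have "X1 v = 0 \<and> X2 v = 0 \<and> X3 v = 0 \<and> X1 u = 0 \<and> X2 u = 0 \<and> X3 u = 0"
    using assms unfolding vec.independent_pair_iff by (metis neg_equal_0_iff_equal)
  then have "1 *s u + 0 *s v = 0" by (simp add: eq_iff_X)
  then show False using assms unfolding vec.independent_pair_iff by (metis zero_neq_one)
qed

text \<open>The entries of the cross product of \<open>u\<close> and \<open>v\<close> are the
  coefficients of the line through them.\<close>

lemma mem_span_pair_iff:
  assumes "u \<noteq> v \<and> vec.independent {u, v}"
  shows "x \<in> vec.span {u, v} \<longleftrightarrow>
    lf (X2 u * X3 v - X3 u * X2 v) (X3 u * X1 v - X1 u * X3 v) (X1 u * X2 v - X2 u * X1 v) x = 0"
    (is "_ \<longleftrightarrow> lf ?a ?b ?c x = 0")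
proof
  assume "x \<in> vec.span {u, v}"
  then show "lf ?a ?b ?c x = 0" by (auto simp: vec.span_pair lf_def algebra_simps)
next
  assume z: "lf ?a ?b ?c x = 0"
  have main: "x \<in> vec.span {u, v}"
    if d: "D \<noteq> 0" and s: "D *s x = p *s u + q *s v" for D p q
  proof -
    have "x = inverse D *s (D *s x)" using d by simp
    also have "\<dots> \<in> vec.span {u, v}" unfolding s
      by (intro vec.span_scale vec.span_add vec.span_base) auto
    finally show ?thesis .
  qed
  consider "?a \<noteq> 0" | "?b \<noteq> 0" | "?c \<noteq> 0" using cross_nonzero[OF assms] by blast
  then show "x \<in> vec.span {u, v}"
  proof cases
    case 1
    show ?thesis
    proof (rule main[OF 1])
      \<comment> \<open>Cramer's rule: two of the coordinates are identities, the remaining one is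
        the equation \<open>z\<close>. The other cases permute the coordinates.\<close>
      show "?a *s x = (X2 x * X3 v - X3 x * X2 v) *s u + (X2 u * X3 x - X3 u * X2 x) *s v"
        unfolding eq_iff_X X_add X_scale by (intro conjI) ((use z[unfolded lf_def] in algebra) | simp add: algebra_simps)+
    qed
  next
    case 2
    show ?thesis
    proof (rule main[OF 2])
      show "?b *s x = (X3 x * X1 v - X1 x * X3 v) *s u + (X3 u * X1 x - X1 u * X3 x) *s v"
        unfolding eq_iff_X X_add X_scale by (intro conjI) ((use z[unfolded lf_def] in algebra) | simp add: algebra_simps)+
    qed
  next
    case 3
    show ?thesis
    proof (rule main[OF 3])
      show "?c *s x = (X1 x * X2 v - X2 x * X1 v) *s u + (X1 u * X2 x - X2 u * X1 x) *s v"
        unfolding eq_iff_X X_add X_scale by (intro conjI) ((use z[unfolded lf_def] in algebra) | simp add: algebra_simps)+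
    qed
  qed
qed

lemma line_imp_lf:
  assumes "line d"
  obtains a b c where "(a, b, c) \<noteq> (0, 0, 0)" "\<And>x. vec.span {x} \<in> d \<longleftrightarrow> x \<noteq> 0 \<and> lf a b c x = 0"
    "d \<subseteq> CP2"
proof -
  obtain u v where uv: "u \<noteq> v \<and> vec.independent {u, v}" and d: "d = vec.proj_points (vec.span {u, v})"
    using assms by (auto simp: line_def vec.proj_line_def)
  have "vec.span {x} \<in> d \<longleftrightarrow> x \<noteq> 0 \<and> x \<in> vec.span {u, v}" for x
  proof
    assume "vec.span {x} \<in> d"
    then obtain y where y: "vec.span {x} = vec.span {y}" "y \<in> vec.span {u, v}" "y \<noteq> 0"
      by (auto simp: d vec.proj_points_def)
    then obtain k where "k \<noteq> 0" "x = k *s y" by (auto simp: vec.span_singleton_eq_iff)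
    with y show "x \<noteq> 0 \<and> x \<in> vec.span {u, v}" by (auto intro: vec.span_scale)
  qed (auto simp: d vec.proj_points_def)
  moreover have "d \<subseteq> CP2" by (auto simp: d CP2_def vec.proj_points_def)
  ultimately show thesis
    by (intro that) (use mem_span_pair_iff[OF uv] cross_nonzero[OF uv] in auto)
qed

text \<open>The forms vanishing at two distinct points are the multiples of their cross product
  form, so any non-zero one of them spans the dual point. A known equation of the join thus replaces
  the computation of the cross product.\<close>

lemma dual_point_join:
  assumes "u \<noteq> 0" "v \<noteq> 0" "vec.span {u} \<noteq> vec.span {v}"
    and "linear_form \<psi>" "\<psi> \<noteq> (\<lambda>_. 0)" "\<psi> u = 0" "\<psi> v = 0"
  shows "dual_point (join (vec.span {u}) (vec.span {v})) = fn.span {\<psi>}"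
proof -
  have ind: "u \<noteq> v \<and> vec.independent {u, v}" using vec.independent_pair_of_span_neq assms(1-3) .
  have sp: "vec.span (vec.span {u} \<union> vec.span {v}) = vec.span {u, v}"
  proof
    have "vec.span {u} \<subseteq> vec.span {u, v}" "vec.span {v} \<subseteq> vec.span {u, v}"
      by (intro vec.span_mono; blast)+
    then show "vec.span (vec.span {u} \<union> vec.span {v}) \<subseteq> vec.span {u, v}"
      by (intro vec.span_minimal vec.subspace_span) blast
    have "{u, v} \<subseteq> vec.span {u} \<union> vec.span {v}" by (auto intro: vec.span_base)
    then show "vec.span {u, v} \<subseteq> vec.span (vec.span {u} \<union> vec.span {v})"
      by (rule vec.span_mono)
  qed
  have dp: "\<phi> \<in> dual_point (join (vec.span {u}) (vec.span {v})) \<longleftrightarrow>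
    linear_form \<phi> \<and> \<phi> u = 0 \<and> \<phi> v = 0" for \<phi>
  proof
    assume "\<phi> \<in> dual_point (join (vec.span {u}) (vec.span {v}))"
    moreover have "vec.span {u} \<in> join (vec.span {u}) (vec.span {v})"
      "vec.span {v} \<in> join (vec.span {u}) (vec.span {v})"
      using assms(1,2) unfolding join_def sp vec.proj_points_def
      by (auto intro: vec.span_base)
    ultimately show "linear_form \<phi> \<and> \<phi> u = 0 \<and> \<phi> v = 0"
      unfolding dual_point_def using vec.span_base[of u "{u}"] vec.span_base[of v "{v}"] by blast
  next
    assume \<phi>: "linear_form \<phi> \<and> \<phi> u = 0 \<and> \<phi> v = 0"
    then have "\<phi> x = 0" if "x \<in> vec.span {u, v}" for x
      using that by (auto simp: vec.span_pair linear_form_iff)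
    then show "\<phi> \<in> dual_point (join (vec.span {u}) (vec.span {v}))"
      using \<phi> unfolding dual_point_def join_def sp vec.proj_points_def
      by (auto simp: vec.span_singleton linear_form_iff)
  qed
  let ?a = "X2 u * X3 v - X3 u * X2 v" and ?b = "X3 u * X1 v - X1 u * X3 v"
    and ?c = "X1 u * X2 v - X2 u * X1 v"
  have nz: "(?a, ?b, ?c) \<noteq> (0, 0, 0)" using cross_nonzero[OF ind] by simp
  have multiple: "\<exists>k. \<phi> = (\<lambda>x. k * lf ?a ?b ?c x)" if "linear_form \<phi>" "\<phi> u = 0" "\<phi> v = 0" for \<phi>
  proof -
    obtain f g h where \<phi>: "\<phi> = lf f g h" using \<open>linear_form \<phi>\<close> linear_form_iff_lf by blast
    \<comment> \<open>The triple product identity \<open>(u x v) x w = (u . w) v - (v . w) u\<close>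
      for the coefficient vector \<open>w = (f, g, h)\<close>.\<close>
    have eqs: "?b * h - ?c * g = X1 v * lf f g h u - X1 u * lf f g h v"
      "?c * f - ?a * h = X2 v * lf f g h u - X2 u * lf f g h v"
      "?a * g - ?b * f = X3 v * lf f g h u - X3 u * lf f g h v"
      by (simp_all add: lf_def algebra_simps)
    have "\<exists>k. f = k * ?a \<and> g = k * ?b \<and> h = k * ?c"
      by (rule proportional_of_cross_zero[OF nz]) (use eqs that in \<open>simp_all add: \<phi>\<close>)
    then obtain k where fgh: "f = k * ?a" "g = k * ?b" "h = k * ?c" by blast
    have "\<phi> = (\<lambda>x. k * lf ?a ?b ?c x)"
      by (simp only: \<phi> fgh lf_def distrib_left mult.assoc)
    then show ?thesis ..
  qed
  obtain m where m: "\<psi> = (\<lambda>x. m * lf ?a ?b ?c x)" using multiple[OF assms(4,6,7)] by blast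
  have m0: "m \<noteq> 0" using m assms(5) by auto
  show ?thesis
  proof (intro set_eqI iffI)
    fix \<phi> assume "\<phi> \<in> dual_point (join (vec.span {u}) (vec.span {v}))"
    then obtain k where "\<phi> = (\<lambda>x. k * lf ?a ?b ?c x)" using multiple unfolding dp by blast
    then have "\<phi> = (\<lambda>x. (k / m) * \<psi> x)" using m0 by (simp add: m)
    then show "\<phi> \<in> fn.span {\<psi>}" unfolding fn.span_singleton by blast
  next
    fix \<phi> assume "\<phi> \<in> fn.span {\<psi>}"
    then show "\<phi> \<in> dual_point (join (vec.span {u}) (vec.span {v}))"
      using assms unfolding dp fn.span_singleton by (auto simp: linear_form_iff algebra_simps)
  qed
qed

section \<open>Quadratic forms in coordinates and the diagonal pencil\<close>

definition qf :: "complex \<Rightarrow> complex \<Rightarrow> complex \<Rightarrow> complex \<Rightarrow> complex \<Rightarrow> complex \<Rightarrow> complex ^ 3 \<Rightarrow> complex" where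
  "qf a b c f g h = (\<lambda>x. a * (X1 x)\<^sup>2 + b * (X2 x)\<^sup>2 + c * (X3 x)\<^sup>2
     + f * (X2 x * X3 x) + g * (X1 x * X3 x) + h * (X1 x * X2 x))"

definition bf :: "complex \<Rightarrow> complex \<Rightarrow> complex \<Rightarrow> complex \<Rightarrow> complex \<Rightarrow> complex
    \<Rightarrow> complex ^ 3 \<Rightarrow> complex ^ 3 \<Rightarrow> complex" where
  "bf a b c f g h = (\<lambda>x y. a * (X1 x * X1 y) + b * (X2 x * X2 y) + c * (X3 x * X3 y)
     + f / 2 * (X2 x * X3 y + X3 x * X2 y) + g / 2 * (X1 x * X3 y + X3 x * X1 y)
     + h / 2 * (X1 x * X2 y + X2 x * X1 y))"

lemma symmetric_bilinear_bf: "symmetric_bilinear (bf a b c f g h)"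
  unfolding symmetric_bilinear_def linear_form_iff bf_def by (simp add: algebra_simps)

lemma qf_eq_bf: "qf a b c f g h = (\<lambda>x. bf a b c f g h x x)"
  unfolding qf_def bf_def by (simp add: power2_eq_square algebra_simps)

lemma quadratic_forms_iff_qf: "q \<in> quadratic_forms \<longleftrightarrow> (\<exists>a b c f g h. q = qf a b c f g h)"
proof
  assume "q \<in> quadratic_forms"
  then obtain B where B: "symmetric_bilinear B" and q: "q = (\<lambda>x. B x x)"
    by (auto simp: quadratic_forms_def)
  have lin: "\<exists>a b c. B y = lf a b c" for y
    using B unfolding symmetric_bilinear_def linear_form_iff_lf by blast
  have B_lf: "B y x = B y e1 * X1 x + B y e2 * X2 x + B y e3 * X3 x" for y x
    using lin[of y] by (auto simp: lf_def)
  have sym: "B x y = B y x" for x y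
    using B by (simp add: symmetric_bilinear_def)
  have "q = qf (B e1 e1) (B e2 e2) (B e3 e3) (2 * B e2 e3) (2 * B e1 e3) (2 * B e1 e2)"
  proof
    fix x
    have "q x = B x e1 * X1 x + B x e2 * X2 x + B x e3 * X3 x"
      unfolding q by (rule B_lf)
    also have "\<dots> = B e1 x * X1 x + B e2 x * X2 x + B e3 x * X3 x"
      by (simp only: sym[of x e1] sym[of x e2] sym[of x e3])
    also have "\<dots> = qf (B e1 e1) (B e2 e2) (B e3 e3) (2 * B e2 e3) (2 * B e1 e3) (2 * B e1 e2) x"
      unfolding B_lf[of e1 x] B_lf[of e2 x] B_lf[of e3 x] sym[of e2 e1] sym[of e3 e1] sym[of e3 e2]
      by (simp add: qf_def power2_eq_square algebra_simps)
    finally show "q x = qf (B e1 e1) (B e2 e2) (B e3 e3) (2 * B e2 e3) (2 * B e1 e3) (2 * B e1 e2) x" .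
  qed
  then show "\<exists>a b c f g h. q = qf a b c f g h" by blast
next
  assume "\<exists>a b c f g h. q = qf a b c f g h"
  then show "q \<in> quadratic_forms"
    unfolding quadratic_forms_def using symmetric_bilinear_bf qf_eq_bf by blast
qed

text \<open>The coefficients of the squares sum to zero, which makes the form vanish wherever all
  coordinates are \<open>1\<close> or \<open>-1\<close>.\<close>

definition diag :: "complex \<Rightarrow> complex \<Rightarrow> complex ^ 3 \<Rightarrow> complex" where
  "diag a b = qf a b (- a - b) 0 0 0"

definition diag_pencil :: "conic set" where
  "diag_pencil = {fn.span {diag a b} | a b. (a, b) \<noteq> (0, 0)}"

text \<open>Inversion of all three coordinates, cleared of denominators.\<close>

definition conj_vec :: "complex ^ 3 \<Rightarrow> complex ^ 3" where
  "conj_vec x = mk (X2 x * X3 x) (X1 x * X3 x) (X1 x * X2 x)"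

lemma span_in_polar_diag_iff:
  "vec.span {y} \<in> polar (fn.span {diag a b}) (vec.span {x}) \<longleftrightarrow>
    y \<noteq> 0 \<and> a * (X1 x * X1 y) + b * (X2 x * X2 y) = (a + b) * (X3 x * X3 y)"
  unfolding diag_def qf_eq_bf span_in_polar_iff[OF symmetric_bilinear_bf]
  by (simp add: bf_def algebra_simps eq_neg_iff_add_eq_0)

lemma span_in_zero_set_qf_iff:
  "vec.span {x} \<in> zero_set (fn.span {qf a b c f g h}) \<longleftrightarrow> x \<noteq> 0 \<and> qf a b c f g h x = 0"
  by (rule span_in_zero_set_iff) (use quadratic_forms_iff_qf in blast)

text \<open>Makes \<open>(a, b)\<close> homogeneous coordinates on the pencil, in the shape that
  \<open>cross_ratio_homogeneous\<close> expects.\<close>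

lemma diag_eq: "diag a b = (\<lambda>x. a * diag 1 0 x) + (\<lambda>x. b * diag 0 1 x)"
  by (auto simp: diag_def qf_def fun_eq_iff algebra_simps)

lemma independent_diag: "diag 1 0 \<noteq> diag 0 1 \<and> fn.independent {diag 1 0, diag 0 1}"
  unfolding fn.independent_pair_iff
proof (intro allI impI)
  fix a b assume "(\<lambda>x. a * diag 1 0 x) + (\<lambda>x. b * diag 0 1 x) = 0"
  then have "diag a b e1 = 0" "diag a b e2 = 0" by (simp_all add: diag_eq[of a b])
  then show "a = 0 \<and> b = 0" by (simp add: diag_def qf_def)
qed

end

section \<open>Poles, conjugation and the two cross ratios for a line missing the frame
  points\<close>

locale frame_line = frame +
  fixes \<alpha> \<beta> \<gamma> :: complex
  assumes nz [simp]: "\<alpha> \<noteq> 0" "\<beta> \<noteq> 0" "\<gamma> \<noteq> 0"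
begin

text \<open>As the coefficients are non-zero, this line misses the spans of \<open>e1\<close>,
  \<open>e2\<close>, \<open>e3\<close>, which turn out to be double points.\<close>

definition dline :: "cpoint set" where
  "dline = {vec.span {x} | x. x \<noteq> 0 \<and> lf \<alpha> \<beta> \<gamma> x = 0}"

text \<open>The point \<open>(\<alpha> / a, \<beta> / b, \<gamma> / c)\<close> with \<open>c = - a - b\<close>, cleared of denominators in order
  to cover the degenerate conics of the pencil.\<close>

definition pole_vec :: "complex \<Rightarrow> complex \<Rightarrow> complex ^ 3" where
  "pole_vec a b = mk (\<alpha> * (b * (- a - b))) (\<beta> * (a * (- a - b))) (\<gamma> * (a * b))"

text \<open>At most one of \<open>a\<close>, \<open>b\<close>, \<open>- a - b\<close> is zero, so
  one of their pairwise products is non-zero.\<close>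

lemma pole_vec_nonzero [simp]: "(a, b) \<noteq> (0, 0) \<Longrightarrow> pole_vec a b \<noteq> 0"
  by (auto simp: pole_vec_def)

text \<open>With \<open>c = - a - b\<close>, a pole \<open>p\<close> is characterized by
  \<open>(a * X1 p, b * X2 p, c * X3 p)\<close> being a multiple of
  \<open>(\<alpha>, \<beta>, \<gamma>)\<close>. This determines \<open>p\<close> up to a scalar even
  if one of \<open>a\<close>, \<open>b\<close>, \<open>c\<close> is zero.\<close>

lemma pole_diag:
  assumes ab: "(a, b) \<noteq> (0, 0)"
  shows "pole (fn.span {diag a b}) dline = vec.span {pole_vec a b}"
  unfolding pole_def
proof (rule the_equality)
  show "vec.span {pole_vec a b} \<in> CP2 \<and>
    (\<forall>Q\<in>dline. vec.span {pole_vec a b} \<in> polar (fn.span {diag a b}) Q)"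
  proof (intro conjI ballI)
    fix Q assume "Q \<in> dline"
    then obtain x where x: "Q = vec.span {x}" "lf \<alpha> \<beta> \<gamma> x = 0" by (auto simp: dline_def)
    show "vec.span {pole_vec a b} \<in> polar (fn.span {diag a b}) Q"
      unfolding x(1) span_in_polar_diag_iff
    proof
      show "a * (X1 x * X1 (pole_vec a b)) + b * (X2 x * X2 (pole_vec a b))
          = (a + b) * (X3 x * X3 (pole_vec a b))"
        unfolding pole_vec_def X_mk using x(2)[unfolded lf_def] by algebra
    qed (use ab in simp)
  qed (use ab in simp)
next
  fix P assume P: "P \<in> CP2 \<and> (\<forall>Q\<in>dline. P \<in> polar (fn.span {diag a b}) Q)"
  then obtain p where p: "p \<noteq> 0" "P = vec.span {p}" by (auto simp: mem_CP2_iff)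
  have eq: "a * (X1 x * X1 p) + b * (X2 x * X2 p) = (a + b) * (X3 x * X3 p)"
    if "x \<noteq> 0" "lf \<alpha> \<beta> \<gamma> x = 0" for x
    using P that span_in_polar_diag_iff unfolding p(2) dline_def by blast
  \<comment> \<open>The test vectors are the intersections of the line with the three coordinate
    lines.\<close>
  have 1: "a * (\<beta> * X1 p) = b * (\<alpha> * X2 p)" using eq[of "mk \<beta> (- \<alpha>) 0"] by (simp add: lf_def)
  have 2: "a * (\<gamma> * X1 p) = - (a + b) * (\<alpha> * X3 p)" using eq[of "mk \<gamma> 0 (- \<alpha>)"] by (simp add: lf_def algebra_simps)
  have 3: "b * (\<gamma> * X2 p) = - (a + b) * (\<beta> * X3 p)" using eq[of "mk 0 \<gamma> (- \<beta>)"] by (simp add: lf_def algebra_simps)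
  have "\<exists>k. X1 p = k * (\<alpha> * (b * (- a - b))) \<and> X2 p = k * (\<beta> * (a * (- a - b))) \<and> X3 p = k * (\<gamma> * (a * b))"
    by (rule proportional_of_cross_zero) (use ab in auto, (use 1 2 3 in algebra)+)
  then obtain k where k: "p = k *s pole_vec a b" by (auto simp: pole_vec_def eq_iff_X)
  moreover have "k \<noteq> 0" using k p by auto
  ultimately show "P = vec.span {pole_vec a b}" unfolding p(2) vec.span_singleton_eq_iff by blast
qed

text \<open>Two conics of the pencil already force the three products \<open>Xi x * Xi p\<close> to
  agree, so \<open>p\<close> is \<open>x\<close> with inverted coordinates. A point of the line has
  at most one zero coordinate, hence \<open>conj_vec x\<close> is non-zero.\<close>

lemma conjugate_point_diag:
  assumes x: "x \<noteq> 0" "lf \<alpha> \<beta> \<gamma> x = 0"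
  shows "conjugate_point diag_pencil (vec.span {x}) = vec.span {conj_vec x}" "conj_vec x \<noteq> 0"
proof -
  have nz2: "(X2 x * X3 x, X1 x * X3 x, X1 x * X2 x) \<noteq> (0, 0, 0)"
    using x by (auto simp: lf_def eq_iff_X)
  then show c0: "conj_vec x \<noteq> 0" by (auto simp: conj_vec_def)
  show "conjugate_point diag_pencil (vec.span {x}) = vec.span {conj_vec x}"
    unfolding conjugate_point_def
  proof (rule the_equality)
    show "vec.span {conj_vec x} \<in> CP2 \<and> (\<forall>\<Gamma>\<in>diag_pencil. vec.span {conj_vec x} \<in> polar \<Gamma> (vec.span {x}))"
      using c0 by (auto simp: diag_pencil_def span_in_polar_diag_iff) (simp_all add: conj_vec_def algebra_simps)
  next
    fix P assume P: "P \<in> CP2 \<and> (\<forall>\<Gamma>\<in>diag_pencil. P \<in> polar \<Gamma> (vec.span {x}))"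
    then obtain p where p: "p \<noteq> 0" "P = vec.span {p}" by (auto simp: mem_CP2_iff)
    have eq: "a * (X1 x * X1 p) + b * (X2 x * X2 p) = (a + b) * (X3 x * X3 p)"
      if "(a, b) \<noteq> (0, 0)" for a b
      using P that span_in_polar_diag_iff unfolding p(2) diag_pencil_def by blast
    have 1: "X1 x * X1 p = X3 x * X3 p" "X2 x * X2 p = X3 x * X3 p"
      using eq[of 1 0] eq[of 0 1] by auto
    have "\<exists>k. X1 p = k * (X2 x * X3 x) \<and> X2 p = k * (X1 x * X3 x) \<and> X3 p = k * (X1 x * X2 x)"
      by (rule proportional_of_cross_zero[OF nz2]) (use 1 in algebra)+
    then obtain k where k: "p = k *s conj_vec x" by (auto simp: conj_vec_def eq_iff_X)
    moreover have "k \<noteq> 0" using k p by auto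
    ultimately show "P = vec.span {conj_vec x}" unfolding p(2) vec.span_singleton_eq_iff by blast
  qed
qed

text \<open>The equation of the line in inverted coordinates, cleared of denominators.\<close>

abbreviation conj_form :: "complex ^ 3 \<Rightarrow> complex" where
  "conj_form \<equiv> qf 0 0 0 \<alpha> \<beta> \<gamma>"

lemma image_conjugate_point:
  "conjugate_point diag_pencil ` dline = {vec.span {conj_vec x} | x. x \<noteq> 0 \<and> lf \<alpha> \<beta> \<gamma> x = 0}"
proof -
  have "dline = (\<lambda>x. vec.span {x}) ` {x. x \<noteq> 0 \<and> lf \<alpha> \<beta> \<gamma> x = 0}"
    by (auto simp: dline_def)
  then show ?thesis by (auto simp: image_image conjugate_point_diag image_iff)
qed

text \<open>Where no coordinate vanishes, inversion is an involution, so a point of the conic is the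
  image of its own inverse. The remaining points of the conic are the spans of \<open>e1\<close>,
  \<open>e2\<close>, \<open>e3\<close>, the images of the intersections of the line with the
  coordinate lines.\<close>

lemma zero_set_conj_form: "zero_set (fn.span {conj_form}) = conjugate_point diag_pencil ` dline"
  unfolding image_conjugate_point
proof (intro set_eqI iffI)
  fix P assume P: "P \<in> zero_set (fn.span {conj_form})"
  then obtain y where y: "P = vec.span {y}" by (auto simp: zero_set_def mem_CP2_iff)
  have y0: "y \<noteq> 0" and q: "\<alpha> * (X2 y * X3 y) + \<beta> * (X1 y * X3 y) + \<gamma> * (X1 y * X2 y) = 0"
    using P unfolding y span_in_zero_set_qf_iff by (simp_all add: qf_def)
  have "\<exists>x. x \<noteq> 0 \<and> lf \<alpha> \<beta> \<gamma> x = 0 \<and> (\<exists>k. k \<noteq> 0 \<and> conj_vec x = k *s y)"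
  proof (cases "X1 y * X2 y * X3 y = 0")
    case False
    then show ?thesis using q
      by (intro exI[of _ "conj_vec y"] conjI exI[of _ "X1 y * X2 y * X3 y"])
        (auto simp: conj_vec_def eq_iff_X lf_def)
  next
    case True
    \<comment> \<open>On the conic, one zero coordinate forces the product of the other two to
      vanish as well.\<close>
    then consider "X1 y = 0" "X2 y = 0" "X3 y \<noteq> 0" | "X1 y = 0" "X2 y \<noteq> 0" "X3 y = 0"
      | "X1 y \<noteq> 0" "X2 y = 0" "X3 y = 0"
      using q y0 by (auto simp: eq_iff_X)
    then show ?thesis
    proof cases
      case 1 then show ?thesis
        by (intro exI[of _ "mk \<beta> (- \<alpha>) 0"] conjI exI[of _ "- (\<alpha> * \<beta>) / X3 y"])
          (auto simp: conj_vec_def eq_iff_X lf_def)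
    next
      case 2 then show ?thesis
        by (intro exI[of _ "mk \<gamma> 0 (- \<alpha>)"] conjI exI[of _ "- (\<alpha> * \<gamma>) / X2 y"])
          (auto simp: conj_vec_def eq_iff_X lf_def)
    next
      case 3 then show ?thesis
        by (intro exI[of _ "mk 0 \<gamma> (- \<beta>)"] conjI exI[of _ "- (\<beta> * \<gamma>) / X1 y"])
          (auto simp: conj_vec_def eq_iff_X lf_def)
    qed
  qed
  then obtain x k where "x \<noteq> 0" "lf \<alpha> \<beta> \<gamma> x = 0" "k \<noteq> 0" "conj_vec x = k *s y" by blast
  then show "P \<in> {vec.span {conj_vec x} | x. x \<noteq> 0 \<and> lf \<alpha> \<beta> \<gamma> x = 0}"
    unfolding y using vec.span_singleton_eq_iff[of "conj_vec x" y] by blast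
next
  fix P assume "P \<in> {vec.span {conj_vec x} | x. x \<noteq> 0 \<and> lf \<alpha> \<beta> \<gamma> x = 0}"
  then obtain x where x: "P = vec.span {conj_vec x}" "x \<noteq> 0" "lf \<alpha> \<beta> \<gamma> x = 0" by blast
  have "conj_form (conj_vec x) = X1 x * X2 x * X3 x * lf \<alpha> \<beta> \<gamma> x"
    by (simp add: qf_def conj_vec_def lf_def algebra_simps)
  then show "P \<in> zero_set (fn.span {conj_form})"
    unfolding x(1) span_in_zero_set_qf_iff using x conjugate_point_diag(2) by simp
qed

lemma conj_form_pole_vec: "conj_form (pole_vec s t) = 0"
  by (simp add: qf_def pole_vec_def algebra_simps)

text \<open>For \<open>x\<close> on the line put \<open>s = \<alpha> * X1 x\<close> and
  \<open>t = \<beta> * X2 x\<close>. Then \<open>- s - t = \<gamma> * X3 x\<close>, and the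
  conjugate of \<open>x\<close> becomes the pole with parameters \<open>s, t\<close>. So the poles
  parametrize the conic.\<close>

lemma mem_zero_set_conj_form_iff:
  "P \<in> zero_set (fn.span {conj_form}) \<longleftrightarrow> (\<exists>s t. (s, t) \<noteq> (0, 0) \<and> P = vec.span {pole_vec s t})"
proof
  assume "P \<in> zero_set (fn.span {conj_form})"
  then obtain x where x: "P = vec.span {conj_vec x}" "x \<noteq> 0" "lf \<alpha> \<beta> \<gamma> x = 0"
    unfolding zero_set_conj_form image_conjugate_point by blast
  have u: "- (\<alpha> * X1 x) - \<beta> * X2 x = \<gamma> * X3 x"
    using x(3) by (simp add: lf_def algebra_simps eq_neg_iff_add_eq_0) (metis neg_eq_iff_add_eq_0)
  have "pole_vec (\<alpha> * X1 x) (\<beta> * X2 x) = (\<alpha> * \<beta> * \<gamma>) *s conj_vec x"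
    unfolding pole_vec_def u by (simp add: conj_vec_def)
  then have "P = vec.span {pole_vec (\<alpha> * X1 x) (\<beta> * X2 x)}"
    unfolding x(1) using vec.span_singleton_eq_iff nz by (metis mult_eq_0_iff)
  moreover have "(\<alpha> * X1 x, \<beta> * X2 x) \<noteq> (0, 0)" using x u by (auto simp: eq_iff_X)
  ultimately show "\<exists>s t. (s, t) \<noteq> (0, 0) \<and> P = vec.span {pole_vec s t}" by blast
next
  assume "\<exists>s t. (s, t) \<noteq> (0, 0) \<and> P = vec.span {pole_vec s t}"
  then obtain s t where "(s, t) \<noteq> (0, 0)" "P = vec.span {pole_vec s t}" by blast
  then show "P \<in> zero_set (fn.span {conj_form})"
    by (simp add: span_in_zero_set_qf_iff conj_form_pole_vec del: prod.inject)
qed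

text \<open>The definite description requires that the zero set determine the form up to a scalar:
  vanishing at \<open>e1\<close>, \<open>e2\<close>, \<open>e3\<close> removes the squares, and two
  further points fix the ratios of the mixed coefficients.\<close>

lemma conjugate_conic_diag: "conjugate_conic diag_pencil dline = fn.span {conj_form}"
  unfolding conjugate_conic_def zero_set_conj_form[symmetric]
proof (rule the_equality)
  have "conj_form (mk 0 1 1) \<noteq> 0" by (simp add: qf_def)
  then have "conj_form \<noteq> 0" by auto
  then show "fn.span {conj_form} \<in> conics \<and> zero_set (fn.span {conj_form}) = zero_set (fn.span {conj_form})"
    unfolding conics_def fn.proj_points_def using quadratic_forms_iff_qf by blast
next
  fix \<C> assume C: "\<C> \<in> conics \<and> zero_set \<C> = zero_set (fn.span {conj_form})"
  then obtain q where q: "\<C> = fn.span {q}" "q \<in> quadratic_forms" "q \<noteq> 0"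
    unfolding conics_def fn.proj_points_def by blast
  then obtain a b c f g h where qf: "q = qf a b c f g h" unfolding quadratic_forms_iff_qf by blast
  have z: "qf a b c f g h y = 0" if "y \<noteq> 0" "conj_form y = 0" for y
    using C that unfolding q(1) qf set_eq_iff by (metis span_in_zero_set_qf_iff)
  have abc: "a = 0" "b = 0" "c = 0"
    using z[of e1] z[of e2] z[of e3] by (auto simp: qf_def eq_iff_X)
  have zp: "qf 0 0 0 f g h (pole_vec s t) = 0" if "(s, t) \<noteq> (0, 0)" for s t
    using z[OF pole_vec_nonzero[OF that] conj_form_pole_vec] unfolding abc .
  have "g * \<gamma> = h * \<beta>" "f * \<gamma> = h * \<alpha>"
  proof -
    \<comment> \<open>The two points have parameters \<open>(1, 1, -2)\<close> and
      \<open>(1, -2, 1)\<close>, with the third one included; no coordinate of theirs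
      vanishes.\<close>
    have 1: "f * (\<beta> * \<gamma>) + g * (\<alpha> * \<gamma>) = 2 * h * (\<alpha> * \<beta>)"
      using zp[of 1 1] by (simp add: qf_def pole_vec_def) algebra
    have 2: "f * (\<beta> * \<gamma>) + h * (\<alpha> * \<beta>) = 2 * g * (\<alpha> * \<gamma>)"
      using zp[of 1 "-2"] by (simp add: qf_def pole_vec_def) algebra
    have "3 * (\<alpha> * (g * \<gamma> - h * \<beta>)) = 0" using 1 2 by algebra
    then show g: "g * \<gamma> = h * \<beta>" by simp
    have "\<beta> * (f * \<gamma> - h * \<alpha>) = 0" using 1 g by algebra
    then show "f * \<gamma> = h * \<alpha>" by simp
  qed
  then have fgh: "f = h / \<gamma> * \<alpha>" "g = h / \<gamma> * \<beta>" "h = h / \<gamma> * \<gamma>" by (simp_all add: field_simps)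
  have "q = (\<lambda>x. (h / \<gamma>) * conj_form x)"
    unfolding qf abc by (subst fgh(1), subst fgh(2), subst (3) fgh(3)) (auto simp: qf_def algebra_simps)
  moreover have "h / \<gamma> \<noteq> 0" using calculation q(3) by (auto simp: fun_eq_iff)
  ultimately show "\<C> = fn.span {conj_form}"
    unfolding q(1) fn.span_singleton_eq_iff by blast
qed

text \<open>If the vectors were proportional with factor \<open>k\<close>, elimination among the
  pairwise products of parameters would give \<open>k * a\<close> and \<open>k * b\<close> times the
  determinant zero, although \<open>k\<close> and one of \<open>a\<close>, \<open>b\<close> are
  non-zero.\<close>

lemma span_pole_vec_neq:
  assumes det: "s * b - t * a \<noteq> 0"
  shows "vec.span {pole_vec s t} \<noteq> vec.span {pole_vec a b}"
proof
  assume "vec.span {pole_vec s t} = vec.span {pole_vec a b}"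
  then obtain k where k: "k \<noteq> 0" and e: "pole_vec s t = k *s pole_vec a b"
    unfolding vec.span_singleton_eq_iff by blast
  have "\<alpha> * (t * (- s - t)) = \<alpha> * (k * (b * (- a - b)))" "\<beta> * (s * (- s - t)) = \<beta> * (k * (a * (- a - b)))"
     "\<gamma> * (s * t) = \<gamma> * (k * (a * b))"
    using e by (simp_all add: pole_vec_def)
  then have e: "t * (- s - t) = k * (b * (- a - b))" "s * (- s - t) = k * (a * (- a - b))"
     "s * t = k * (a * b)" by (metis mult_left_cancel nz)+
  have "k * a * (s * b - t * a) = 0" "k * b * (s * b - t * a) = 0" using e by algebra+
  then show False using det k by auto
qed

text \<open>The point of the conic with parameters \<open>s, t\<close> is itself the pole of the line with respect
  to a conic of the pencil. The form of the line joining it to the pole with parameters \<open>a, b\<close>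
  is linear in \<open>a, b\<close>, which identifies the two cross ratios.\<close>

definition join_form1 :: "complex \<Rightarrow> complex \<Rightarrow> complex ^ 3 \<Rightarrow> complex" where
  "join_form1 s t = lf (s / \<alpha>) 0 ((s + t) / \<gamma>)"

definition join_form2 :: "complex \<Rightarrow> complex \<Rightarrow> complex ^ 3 \<Rightarrow> complex" where
  "join_form2 s t = lf 0 (t / \<beta>) ((s + t) / \<gamma>)"

text \<open>Evaluation at the frame gives \<open>a s = b t = (a + b) (s + t) = 0\<close>. This also
  settles the points of the conic for which \<open>s\<close>, \<open>t\<close> or
  \<open>s + t\<close> is zero.\<close>

lemma independent_join_forms:
  assumes st: "(s, t) \<noteq> (0, 0)"
  shows "join_form1 s t \<noteq> join_form2 s t \<and> fn.independent {join_form1 s t, join_form2 s t}"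
  unfolding fn.independent_pair_iff
proof (intro allI impI)
  fix a b assume e: "(\<lambda>x. a * join_form1 s t x) + (\<lambda>x. b * join_form2 s t x) = 0"
  have "a * join_form1 s t x + b * join_form2 s t x = 0" for x
    using fun_cong[OF e, of x] by simp
  from this[of e1] this[of e2] this[of e3]
  have "a * s = 0" "b * t = 0" "(a + b) * ((s + t) / \<gamma>) = 0"
    unfolding distrib_right by (simp_all add: join_form1_def join_form2_def lf_def)
  then show "a = 0 \<and> b = 0" using st by auto
qed

text \<open>With \<open>c = - a - b\<close> and \<open>u = - s - t\<close>, the form has
  coefficients \<open>a s / \<alpha>\<close>, \<open>b t / \<beta>\<close>,
  \<open>c u / \<gamma>\<close>. Its values at the two poles are \<open>s t u (a + b + c)\<close>
  and \<open>a b c (s + t + u)\<close>, both zero.\<close>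

lemma dual_point_join_pole_vec:
  assumes st: "(s, t) \<noteq> (0, 0)" and ab: "(a, b) \<noteq> (0, 0)"
    and ne: "vec.span {pole_vec s t} \<noteq> vec.span {pole_vec a b}"
  shows "dual_point (join (vec.span {pole_vec s t}) (vec.span {pole_vec a b}))
    = fn.span {(\<lambda>x. a * join_form1 s t x) + (\<lambda>x. b * join_form2 s t x)}" (is "_ = fn.span {?\<psi>}")
proof (rule dual_point_join[OF _ _ ne])
  show "?\<psi> \<noteq> (\<lambda>_. 0)"
    using independent_join_forms[OF st] ab unfolding fn.independent_pair_iff
    by (auto simp: zero_fun_def)
  show "linear_form ?\<psi>"
    by (simp add: linear_form_iff join_form1_def join_form2_def lf_def algebra_simps add_divide_distrib)
  show "?\<psi> (pole_vec s t) = 0" "?\<psi> (pole_vec a b) = 0"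
    by (simp_all add: join_form1_def join_form2_def lf_def pole_vec_def) (algebra+)
qed (use st ab in auto)

text \<open>The conics and the lines joining a fixed point of the conic to their poles have the same
  homogeneous coordinates, in the bases \<open>diag 1 0\<close>, \<open>diag 0 1\<close> and
  \<open>join_form1 s t\<close>, \<open>join_form2 s t\<close>. Hence both cross ratios are
  \<open>?k\<close>.\<close>

lemma cross_ratio_poles:
  assumes nzd: "a * b' - a' * b \<noteq> 0" "a * c' - a' * c \<noteq> 0" "b * c' - b' * c \<noteq> 0"
      "a * d' - a' * d \<noteq> 0" "b * d' - b' * d \<noteq> 0" "c * d' - c' * d \<noteq> 0"
  shows "fn.cross_ratio (fn.span {diag a a'}) (fn.span {diag b b'}) (fn.span {diag c c'}) (fn.span {diag d d'})
    = conic_cross_ratio (conjugate_conic diag_pencil dline)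
        (pole (fn.span {diag a a'}) dline) (pole (fn.span {diag b b'}) dline)
        (pole (fn.span {diag c c'}) dline) (pole (fn.span {diag d d'}) dline)"
proof -
  have inf: "infinite (UNIV :: complex set)" by (rule infinite_UNIV_char_0)
  let ?k = "((a * c' - a' * c) * (b * d' - b' * d)) / ((b * c' - b' * c) * (a * d' - a' * d))"
  have nza: "(a, a') \<noteq> (0, 0)" "(b, b') \<noteq> (0, 0)" "(c, c') \<noteq> (0, 0)" "(d, d') \<noteq> (0, 0)"
    using nzd by auto
  have L: "fn.cross_ratio (fn.span {diag a a'}) (fn.span {diag b b'}) (fn.span {diag c c'}) (fn.span {diag d d'}) = ?k"
    using fn.cross_ratio_homogeneous[OF independent_diag inf nzd(1-5)] by (simp only: diag_eq[symmetric])
  let ?Z = "zero_set (fn.span {conj_form}) - {vec.span {pole_vec a a'}, vec.span {pole_vec b b'},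
    vec.span {pole_vec c c'}, vec.span {pole_vec d d'}}"
  have all: "line_cross_ratio (join P (vec.span {pole_vec a a'})) (join P (vec.span {pole_vec b b'}))
      (join P (vec.span {pole_vec c c'})) (join P (vec.span {pole_vec d d'})) = ?k" if "P \<in> ?Z" for P
  proof -
    obtain s t where st: "(s, t) \<noteq> (0, 0)" and P: "P = vec.span {pole_vec s t}"
      using \<open>P \<in> ?Z\<close> mem_zero_set_conj_form_iff by auto
    have ne: "vec.span {pole_vec s t} \<noteq> vec.span {pole_vec a a'}"
      "vec.span {pole_vec s t} \<noteq> vec.span {pole_vec b b'}"
      "vec.span {pole_vec s t} \<noteq> vec.span {pole_vec c c'}"
      "vec.span {pole_vec s t} \<noteq> vec.span {pole_vec d d'}"
      using \<open>P \<in> ?Z\<close> unfolding P by auto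
    show ?thesis
      unfolding line_cross_ratio_def P dual_point_join_pole_vec[OF st nza(1) ne(1)]
        dual_point_join_pole_vec[OF st nza(2) ne(2)] dual_point_join_pole_vec[OF st nza(3) ne(3)]
        dual_point_join_pole_vec[OF st nza(4) ne(4)]
      by (rule fn.cross_ratio_homogeneous[OF independent_join_forms[OF st] inf nzd(1-5)])
  qed
  \<comment> \<open>The value of \<open>conic_cross_ratio\<close> is determined only if the conic
    has a point besides the four poles. The one with parameters \<open>1, t\<close> serves, since
    \<open>t\<close> avoids the parameter ratios of the four conics.\<close>
  obtain t where t: "t \<notin> {a' / a, b' / b, c' / c, d' / d}"
    using ex_new_if_finite[OF inf, of "{a' / a, b' / b, c' / c, d' / d}"] by auto
  have "1 * y' - t * y \<noteq> 0" if "t \<noteq> y' / y" "(y, y') \<noteq> (0, 0)" for y y'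
    using that by (cases "y = 0") (auto simp: field_simps)
  then have "1 * a' - t * a \<noteq> 0" "1 * b' - t * b \<noteq> 0" "1 * c' - t * c \<noteq> 0" "1 * d' - t * d \<noteq> 0"
    using t nza by blast+
  note neq = this[THEN span_pole_vec_neq]
  have "vec.span {pole_vec 1 t} \<in> zero_set (fn.span {conj_form})"
    unfolding mem_zero_set_conj_form_iff by (intro exI[of _ 1] exI[of _ t]) simp
  with neq have ex: "vec.span {pole_vec 1 t} \<in> ?Z" by simp
  have "(THE k. \<forall>P\<in>?Z. line_cross_ratio (join P (vec.span {pole_vec a a'})) (join P (vec.span {pole_vec b b'}))
      (join P (vec.span {pole_vec c c'})) (join P (vec.span {pole_vec d d'})) = k) = ?k"
  proof (rule the_equality)
    fix k
    assume "\<forall>P\<in>?Z. line_cross_ratio (join P (vec.span {pole_vec a a'})) (join P (vec.span {pole_vec b b'}))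
      (join P (vec.span {pole_vec c c'})) (join P (vec.span {pole_vec d d'})) = k"
    from bspec[OF this ex] show "k = ?k" using all[OF ex] by simp
  qed (use all in blast)
  then show ?thesis
    unfolding L pole_diag[OF nza(1)] pole_diag[OF nza(2)] pole_diag[OF nza(3)] pole_diag[OF nza(4)]
      conjugate_conic_diag conic_cross_ratio_def by simp
qed

end

section \<open>Lines, double points and base points in coordinates\<close>

context frame
begin

text \<open>Two solutions of the equation span the line as soon as their cross product is a non-zero
  multiple of \<open>(a, b, c)\<close>; a non-zero coefficient tells which two to take.\<close>

lemma line_lf:
  assumes "(a, b, c) \<noteq> (0, 0, 0)"
  shows "line {vec.span {x} | x. x \<noteq> 0 \<and> lf a b c x = 0}"
proof -
  have main: "line {vec.span {x} | x. x \<noteq> 0 \<and> lf a b c x = 0}"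
    if k: "k \<noteq> 0" "X2 u * X3 v - X3 u * X2 v = k * a" "X3 u * X1 v - X1 u * X3 v = k * b"
      "X1 u * X2 v - X2 u * X1 v = k * c" for k u v
  proof -
    have "x = 0 \<and> y = 0" if "x *s u + y *s v = 0" for x y
    proof -
      have eqs: "x * X1 u + y * X1 v = 0" "x * X2 u + y * X2 v = 0" "x * X3 u + y * X3 v = 0"
        using that by (simp_all add: eq_iff_X)
      have "x * (X2 u * X3 v - X3 u * X2 v) = X3 v * (x * X2 u + y * X2 v) - X2 v * (x * X3 u + y * X3 v)"
        "x * (X3 u * X1 v - X1 u * X3 v) = X1 v * (x * X3 u + y * X3 v) - X3 v * (x * X1 u + y * X1 v)"
        "x * (X1 u * X2 v - X2 u * X1 v) = X2 v * (x * X1 u + y * X1 v) - X1 v * (x * X2 u + y * X2 v)"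
        "y * (X2 u * X3 v - X3 u * X2 v) = X2 u * (x * X3 u + y * X3 v) - X3 u * (x * X2 u + y * X2 v)"
        "y * (X3 u * X1 v - X1 u * X3 v) = X3 u * (x * X1 u + y * X1 v) - X1 u * (x * X3 u + y * X3 v)"
        "y * (X1 u * X2 v - X2 u * X1 v) = X1 u * (x * X2 u + y * X2 v) - X2 u * (x * X1 u + y * X1 v)"
        by (simp_all add: algebra_simps)
      then have "x * (k * a) = 0" "x * (k * b) = 0" "x * (k * c) = 0"
        "y * (k * a) = 0" "y * (k * b) = 0" "y * (k * c) = 0"
        unfolding k(2-4) eqs by simp_all
      then show ?thesis using assms k(1) by auto
    qed
    then have uv: "u \<noteq> v \<and> vec.independent {u, v}" unfolding vec.independent_pair_iff by blast
    have "lf (k * a) (k * b) (k * c) x = k * lf a b c x" for x by (simp add: lf_def algebra_simps)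
    then have "x \<in> vec.span {u, v} \<longleftrightarrow> lf a b c x = 0" for x
      unfolding mem_span_pair_iff[OF uv] k(2-4) using k(1) by simp
    then have "vec.proj_points (vec.span {u, v}) = {vec.span {x} | x. x \<noteq> 0 \<and> lf a b c x = 0}"
      unfolding vec.proj_points_def by blast
    then show ?thesis using uv unfolding line_def vec.proj_line_def by blast
  qed
  consider "a \<noteq> 0" | "b \<noteq> 0" | "c \<noteq> 0" using assms by auto
  then show ?thesis
  proof cases
    case 1 show ?thesis by (rule main[of a "mk b (- a) 0" "mk c 0 (- a)"]) (use 1 in simp_all)
  next
    case 2 show ?thesis by (rule main[of "- b" "mk (- b) a 0" "mk 0 c (- b)"]) (use 2 in simp_all)
  next
    case 3 show ?thesis by (rule main[of c "mk (- c) 0 a" "mk 0 (- c) b"]) (use 3 in simp_all)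
  qed
qed

text \<open>The factorization exhibits the conic as a pair of lines; \<open>w\<close> lies on the
  first only and so tells them apart.\<close>

lemma double_point_of_product:
  assumes "(a, b) \<noteq> (0, 0)" and prod: "\<And>x. diag a b x = lf l1 l2 l3 x * lf m1 m2 m3 x"
    and "(l1, l2, l3) \<noteq> (0, 0, 0)" "(m1, m2, m3) \<noteq> (0, 0, 0)"
    and w: "lf l1 l2 l3 w = 0" "lf m1 m2 m3 w \<noteq> 0"
    and p: "p \<noteq> 0" "lf l1 l2 l3 p = 0" "lf m1 m2 m3 p = 0"
  shows "vec.span {p} \<in> double_points diag_pencil"
proof -
  define l m where "l = {vec.span {x} | x. x \<noteq> 0 \<and> lf l1 l2 l3 x = 0}"
    and "m = {vec.span {x} | x. x \<noteq> 0 \<and> lf m1 m2 m3 x = 0}"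
  have w0: "w \<noteq> 0" using w by (auto simp: lf_def)
  have "vec.span {w} \<notin> m"
  proof
    assume "vec.span {w} \<in> m"
    then obtain x where "vec.span {w} = vec.span {x}" "lf m1 m2 m3 x = 0" by (auto simp: m_def)
    then obtain k where "w = k *s x" by (auto simp: vec.span_singleton_eq_iff)
    moreover have "lf m1 m2 m3 (k *s x) = k * lf m1 m2 m3 x" by (simp add: lf_def algebra_simps)
    ultimately show False using w \<open>lf m1 m2 m3 x = 0\<close> by simp
  qed
  moreover have "vec.span {w} \<in> l" using w0 w by (auto simp: l_def)
  ultimately have "l \<noteq> m" by blast
  moreover have "line l" "line m" unfolding l_def m_def using assms by (blast intro: line_lf)+
  moreover have "zero_set (fn.span {diag a b}) = l \<union> m"
  proof (intro set_eqI)
    fix P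
    have *: "vec.span {x} \<in> zero_set (fn.span {diag a b}) \<longleftrightarrow>
        x \<noteq> 0 \<and> (lf l1 l2 l3 x = 0 \<or> lf m1 m2 m3 x = 0)" for x
      using span_in_zero_set_qf_iff[of x a b] prod[of x] unfolding diag_def by simp
    show "P \<in> zero_set (fn.span {diag a b}) \<longleftrightarrow> P \<in> l \<union> m"
    proof
      assume P: "P \<in> zero_set (fn.span {diag a b})"
      then obtain x where "P = vec.span {x}" by (auto simp: zero_set_def mem_CP2_iff)
      with P show "P \<in> l \<union> m" using * unfolding l_def m_def by blast
    next
      assume "P \<in> l \<union> m"
      then show "P \<in> zero_set (fn.span {diag a b})" using * unfolding l_def m_def by blast
    qed
  qed
  moreover have "vec.span {p} \<in> l \<inter> m" using p by (auto simp: l_def m_def)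
  moreover have "fn.span {diag a b} \<in> diag_pencil" using assms(1) unfolding diag_pencil_def by blast
  ultimately show ?thesis unfolding double_points_def by blast
qed

text \<open>The pencil contains the differences of squares \<open>y^2 - z^2\<close>,
  \<open>x^2 - z^2\<close> and \<open>x^2 - y^2\<close>, which factor into pairs of lines meeting at
  \<open>e1\<close>, \<open>e2\<close> and \<open>e3\<close>.\<close>

lemma frame_double_points:
  "vec.span {e1} \<in> double_points diag_pencil" "vec.span {e2} \<in> double_points diag_pencil"
  "vec.span {e3} \<in> double_points diag_pencil"
proof -
  have d: "diag a b x = a * (X1 x)\<^sup>2 + b * (X2 x)\<^sup>2 - (a + b) * (X3 x)\<^sup>2" for a b x
    by (simp add: diag_def qf_def algebra_simps)
  have prod: "diag 0 1 x = lf 0 1 (- 1) x * lf 0 1 1 x" "diag 1 0 x = lf 1 0 (- 1) x * lf 1 0 1 x"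
    "diag 1 (- 1) x = lf 1 (- 1) 0 x * lf 1 1 0 x" for x
    unfolding d lf_def by algebra+
  show "vec.span {e1} \<in> double_points diag_pencil"
    by (rule double_point_of_product[OF _ prod(1), of "mk 0 1 1"]) (simp_all add: lf_def eq_iff_X)
  show "vec.span {e2} \<in> double_points diag_pencil"
    by (rule double_point_of_product[OF _ prod(2), of "mk 1 0 1"]) (simp_all add: lf_def eq_iff_X)
  show "vec.span {e3} \<in> double_points diag_pencil"
    by (rule double_point_of_product[OF _ prod(3), of "mk 1 1 0"]) (simp_all add: lf_def eq_iff_X)
qed

text \<open>Signed sums of the four vanishing conditions isolate \<open>4 f\<close>,
  \<open>4 g\<close>, \<open>4 h\<close> and \<open>4 (a + b + c)\<close>, leaving a diagonal form
  with coefficient sum zero.\<close>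

lemma conics_through_base_points:
  "{\<Gamma> \<in> conics. {vec.span {mk (-1) 1 1}, vec.span {mk 1 (-1) 1}, vec.span {mk 1 1 (-1)},
      vec.span {mk 1 1 1}} \<subseteq> zero_set \<Gamma>} = diag_pencil" (is "?F = _")
proof (intro set_eqI iffI)
  fix \<Gamma> assume \<Gamma>: "\<Gamma> \<in> ?F"
  then obtain q where q: "\<Gamma> = fn.span {q}" "q \<in> quadratic_forms" "q \<noteq> 0"
    unfolding conics_def fn.proj_points_def by blast
  then obtain a b c f g h where qf: "q = qf a b c f g h" unfolding quadratic_forms_iff_qf by blast
  have eqs: "a + b + c + f - g - h = 0" "a + b + c - f + g - h = 0"
    "a + b + c - f - g + h = 0" "a + b + c + f + g + h = 0"
    using \<Gamma> unfolding q(1) qf by (simp_all add: span_in_zero_set_qf_iff) (simp_all add: qf_def)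
  have "4 * f = (a + b + c + f - g - h) - (a + b + c - f + g - h) - (a + b + c - f - g + h) + (a + b + c + f + g + h)"
    "4 * g = (a + b + c - f + g - h) - (a + b + c + f - g - h) - (a + b + c - f - g + h) + (a + b + c + f + g + h)"
    "4 * h = (a + b + c - f - g + h) - (a + b + c + f - g - h) - (a + b + c - f + g - h) + (a + b + c + f + g + h)"
    "4 * (a + b + c) = (a + b + c + f - g - h) + (a + b + c - f + g - h) + (a + b + c - f - g + h) + (a + b + c + f + g + h)"
    by (simp_all add: algebra_simps)
  then have "4 * f = 0" "4 * g = 0" "4 * h = 0" "4 * (a + b + c) = 0" unfolding eqs by simp_all
  then have fgh: "f = 0" "g = 0" "h = 0" and "a + b + c = 0" by (simp_all only: mult_eq_0_iff) simp_all
  then have "c = - a - b" by algebra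
  with fgh have d: "q = diag a b" by (simp add: qf diag_def)
  have "diag 0 0 = 0" by (auto simp: diag_def qf_def)
  then have "(a, b) \<noteq> (0, 0)" using q(3) d by auto
  then show "\<Gamma> \<in> diag_pencil" unfolding q(1) d diag_pencil_def by blast
next
  fix \<Gamma> assume "\<Gamma> \<in> diag_pencil"
  then obtain a b where ab: "(a, b) \<noteq> (0, 0)" and \<Gamma>: "\<Gamma> = fn.span {diag a b}"
    unfolding diag_pencil_def by blast
  have "diag a b e1 = a" "diag a b e2 = b" by (simp_all add: diag_def qf_def)
  then have "diag a b \<noteq> 0" using ab by auto
  moreover have "diag a b \<in> quadratic_forms" unfolding diag_def quadratic_forms_iff_qf by blast
  ultimately have "\<Gamma> \<in> conics" unfolding \<Gamma> conics_def fn.proj_points_def by blast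
  then show "\<Gamma> \<in> ?F" unfolding \<Gamma> diag_def by (simp add: span_in_zero_set_qf_iff) (simp add: qf_def)
qed

end

section \<open>Construction of a frame adapted to four base points\<close>

text \<open>The linear map sending the standard basis to \<open>e1\<close>, \<open>e2\<close>,
  \<open>e3\<close> is injective, hence bijective by dimension; the coordinate functions are the
  components of its inverse.\<close>

lemma frame_exists:
  assumes ind: "\<And>x y z. x *s e1 + y *s e2 + z *s e3 = 0 \<Longrightarrow> x = 0 \<and> y = 0 \<and> z = 0"
  obtains X1 X2 X3 where "frame e1 e2 e3 X1 X2 X3"
proof -
  define L :: "complex ^ 3 \<Rightarrow> complex ^ 3" where "L x = x $ 1 *s e1 + x $ 2 *s e2 + x $ 3 *s e3" for x
  have lin: "Vector_Spaces.linear (*s) (*s) L"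
    by unfold_locales (auto simp: L_def vec.scale_right_distrib vec.scale_left_distrib)
  have inj: "inj L"
    unfolding vec.linear_inj_iff_eq_0[OF lin]
  proof (intro allI impI)
    fix x assume "L x = 0"
    from ind[OF this[unfolded L_def]] show "x = 0" by (simp add: vec_eq_iff[of x] forall_3)
  qed
  have surj: "surj L" by (rule vec.linear_inj_imp_surj[OF lin inj])
  define K where "K = inv L"
  have LK: "L (K x) = x" for x using surj by (simp add: K_def surj_f_inv_f)
  have KL: "K (L x) = x" for x using inj by (simp add: K_def)
  have add: "K (x + y) = K x + K y" for x y
    using KL[of "K x + K y"] by (simp add: vec.linear_add[OF lin] LK)
  have scale: "K (c *s x) = c *s K x" for c x
    using KL[of "c *s K x"] by (simp add: vec.linear_scale[OF lin] LK)
  have e: "e1 = L (axis 1 1)" "e2 = L (axis 2 1)" "e3 = L (axis 3 1)"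
    by (simp_all add: L_def axis_def)
  have Ke: "K e1 = axis 1 1" "K e2 = axis 2 1" "K e3 = axis 3 1"
    using KL[of "axis 1 1"] KL[of "axis 2 1"] KL[of "axis 3 1"] by (simp_all only: e[symmetric])
  have "frame e1 e2 e3 (\<lambda>x. K x $ 1) (\<lambda>x. K x $ 2) (\<lambda>x. K x $ 3)"
  proof
    fix x show "x = K x $ 1 *s e1 + K x $ 2 *s e2 + K x $ 3 *s e3"
      using LK[of x, symmetric] unfolding L_def .
  qed (simp_all add: linear_form_iff add scale Ke, simp_all add: axis_def)
  then show thesis by (rule that)
qed

lemma collinear_points_perm:
  "collinear_points A B C \<longleftrightarrow> collinear_points A C B" "collinear_points A B C \<longleftrightarrow> collinear_points C B A"
  unfolding collinear_points_def by blast+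

text \<open>A vector with non-zero coefficient in the relation lies in the span of the other two;
  \<open>main\<close> treats the last vector, and symmetry of collinearity the others.\<close>

lemma collinear_points_of_dependent:
  assumes nz: "a \<noteq> 0" "b \<noteq> 0" "c \<noteq> 0"
    and ne: "vec.span {a} \<noteq> vec.span {b}" "vec.span {a} \<noteq> vec.span {c}" "vec.span {b} \<noteq> vec.span {c}"
    and dep: "x *s a + y *s b + z *s c = 0" "(x, y, z) \<noteq> (0, 0, 0)"
  shows "collinear_points (vec.span {a}) (vec.span {b}) (vec.span {c})"
proof -
  have main: "collinear_points (vec.span {u}) (vec.span {v}) (vec.span {w})"
    if "u \<noteq> 0" "v \<noteq> 0" "w \<noteq> 0" "vec.span {u} \<noteq> vec.span {v}" "r *s u + s *s v + t *s w = 0" "t \<noteq> 0"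
    for u v w r s t
  proof -
    have uv: "u \<noteq> v \<and> vec.independent {u, v}" using that vec.independent_pair_of_span_neq by blast
    have "w = (- 1 / t) *s (r *s u + s *s v)"
      using that(5,6) by (simp add: vec_eq_iff field_simps) (metis add.commute add_eq_0_iff)
    moreover have "(- 1 / t) *s (r *s u + s *s v) \<in> vec.span {u, v}"
      by (intro vec.span_scale vec.span_add vec.span_base) auto
    ultimately have "w \<in> vec.span {u, v}" by simp
    moreover have "u \<in> vec.span {u, v}" "v \<in> vec.span {u, v}" by (auto intro: vec.span_base)
    ultimately show ?thesis
      unfolding collinear_points_def line_def vec.proj_line_def
      using uv that(1-3) by (intro exI[of _ "vec.proj_points (vec.span {u, v})"])
        (auto simp: vec.proj_points_def)
  qed
  consider "z \<noteq> 0" | "y \<noteq> 0" | "x \<noteq> 0" using dep by auto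
  then show ?thesis
  proof cases
    case 1 then show ?thesis using main[OF nz ne(1) dep(1)] by blast
  next
    case 2
    have "x *s a + z *s c + y *s b = 0" using dep(1) by (simp add: algebra_simps)
    from main[OF nz(1,3,2) ne(2) this 2] show ?thesis by (simp only: collinear_points_perm(1))
  next
    case 3
    have "z *s c + y *s b + x *s a = 0" using dep(1) by (simp add: algebra_simps)
    from main[OF nz(3,2,1) ne(3)[symmetric] this 3] show ?thesis by (simp only: collinear_points_perm(2))
  qed
qed

text \<open>Non-collinearity of \<open>A\<close>, \<open>B\<close>, \<open>C\<close> makes
  \<open>a\<close>, \<open>b\<close>, \<open>c\<close> a basis. A zero coefficient of
  \<open>d\<close> in it would put \<open>D\<close> on a line through two of the other
  points.\<close>

lemma adapted_frame:
  assumes CP2: "{A, B, C, D} \<subseteq> CP2" and dist: "distinct [A, B, C, D]"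
    and nc: "\<not> collinear_points A B C" "\<not> collinear_points A B D"
      "\<not> collinear_points A C D" "\<not> collinear_points B C D"
  obtains e1 e2 e3 X1 X2 X3 where "frame e1 e2 e3 X1 X2 X3"
    "A = vec.span {frame.mk e1 e2 e3 (-1) 1 1}" "B = vec.span {frame.mk e1 e2 e3 1 (-1) 1}"
    "C = vec.span {frame.mk e1 e2 e3 1 1 (-1)}" "D = vec.span {frame.mk e1 e2 e3 1 1 1}"
proof -
  obtain a b c d where nz: "a \<noteq> 0" "b \<noteq> 0" "c \<noteq> 0" "d \<noteq> 0" and
    ABCD: "A = vec.span {a}" "B = vec.span {b}" "C = vec.span {c}" "D = vec.span {d}"
    using CP2 by (auto simp: mem_CP2_iff)
  have ne: "vec.span {a} \<noteq> vec.span {b}" "vec.span {a} \<noteq> vec.span {c}" "vec.span {a} \<noteq> vec.span {d}"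
    "vec.span {b} \<noteq> vec.span {c}" "vec.span {b} \<noteq> vec.span {d}" "vec.span {c} \<noteq> vec.span {d}"
    using dist by (simp_all add: ABCD)
  note nc = nc[unfolded ABCD]
  have ind: "x = 0 \<and> y = 0 \<and> z = 0" if "x *s a + y *s b + z *s c = 0" for x y z
    using collinear_points_of_dependent[OF nz(1-3) ne(1,2,4) that] nc(1) by blast
  obtain Y1 Y2 Y3 where Y: "frame a b c Y1 Y2 Y3" using frame_exists[OF ind] by blast
  define k l m where "k = Y1 d" "l = Y2 d" "m = Y3 d"
  have d: "d = k *s a + l *s b + m *s c" unfolding k_l_m_def by (rule frame.expansion[OF Y])
  have "m \<noteq> 0"
  proof
    assume "m = 0"
    then have "k *s a + l *s b + (-1) *s d = 0" using d by simp
    from collinear_points_of_dependent[OF nz(1,2,4) ne(1,3,5) this] nc(2) show False by simp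
  qed
  have "l \<noteq> 0"
  proof
    assume "l = 0"
    then have "k *s a + m *s c + (-1) *s d = 0" using d by simp
    from collinear_points_of_dependent[OF nz(1,3,4) ne(2,3,6) this] nc(3) show False by simp
  qed
  have "k \<noteq> 0"
  proof
    assume "k = 0"
    then have "l *s b + m *s c + (-1) *s d = 0" using d by simp
    from collinear_points_of_dependent[OF nz(2,3,4) ne(4,5,6) this] nc(4) show False by simp
  qed
  \<comment> \<open>The solution of \<open>- e1 + e2 + e3 = k a\<close>,
    \<open>e1 - e2 + e3 = l b\<close>, \<open>e1 + e2 - e3 = m c\<close>; adding up gives
    \<open>e1 + e2 + e3 = d\<close>.\<close>
  define e1 e2 e3 where "e1 = (1/2) *s (l *s b + m *s c)" "e2 = (1/2) *s (k *s a + m *s c)"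
    "e3 = (1/2) *s (k *s a + l *s b)"
  note e_def = e1_e2_e3_def
  have "x = 0 \<and> y = 0 \<and> z = 0" if "x *s e1 + y *s e2 + z *s e3 = 0" for x y z
  proof -
    have "((y + z) * k / 2) *s a + ((x + z) * l / 2) *s b + ((x + y) * m / 2) *s c = 0"
      using that unfolding e_def by (simp add: vec_eq_iff algebra_simps add_divide_distrib)
    from ind[OF this] have "y + z = 0" "x + z = 0" "x + y = 0"
      using \<open>k \<noteq> 0\<close> \<open>l \<noteq> 0\<close> \<open>m \<noteq> 0\<close> by auto
    then have "2 * x = 0" "2 * y = 0" "2 * z = 0" by algebra+
    then show ?thesis by simp
  qed
  then obtain X1 X2 X3 where X: "frame e1 e2 e3 X1 X2 X3" using frame_exists by blast
  note mk = frame.mk_def[OF X]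
  have mk: "frame.mk e1 e2 e3 (-1) 1 1 = k *s a" "frame.mk e1 e2 e3 1 (-1) 1 = l *s b"
    "frame.mk e1 e2 e3 1 1 (-1) = m *s c" "frame.mk e1 e2 e3 1 1 1 = d"
    unfolding mk unfolding d e_def by (simp_all add: vec_eq_iff field_simps)
  have "vec.span {r *s x} = vec.span {x}" if "r \<noteq> 0" for r and x :: "complex ^ 3"
    using that vec.span_singleton_eq_iff by blast
  then show thesis
    by (intro that[OF X]) (simp_all add: ABCD mk \<open>k \<noteq> 0\<close> \<open>l \<noteq> 0\<close> \<open>m \<noteq> 0\<close>)
qed

section \<open>Transfer of the computation to an arbitrary non-degenerate pencil\<close>

theorem theorem2:
  fixes F :: "conic set" and R S T :: cpoint and d :: "cpoint set"
    and \<Gamma>\<^sub>1 \<Gamma>\<^sub>2 \<Gamma>\<^sub>3 \<Gamma>\<^sub>4 \<C> :: conic and P\<^sub>1 P\<^sub>2 P\<^sub>3 P\<^sub>4 :: cpoint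
  assumes "nondegenerate_pencil F"
    and "double_points F = {R, S, T}"
    and "{\<Gamma>\<^sub>1, \<Gamma>\<^sub>2, \<Gamma>\<^sub>3, \<Gamma>\<^sub>4} \<subseteq> F" and "distinct [\<Gamma>\<^sub>1, \<Gamma>\<^sub>2, \<Gamma>\<^sub>3, \<Gamma>\<^sub>4]"
    and "line d" and "R \<notin> d" and "S \<notin> d" and "T \<notin> d"
    and "\<C> = conjugate_conic F d"
    and "P\<^sub>1 = pole \<Gamma>\<^sub>1 d" and "P\<^sub>2 = pole \<Gamma>\<^sub>2 d" and "P\<^sub>3 = pole \<Gamma>\<^sub>3 d" and "P\<^sub>4 = pole \<Gamma>\<^sub>4 d"
  shows "fn.cross_ratio \<Gamma>\<^sub>1 \<Gamma>\<^sub>2 \<Gamma>\<^sub>3 \<Gamma>\<^sub>4 = conic_cross_ratio \<C> P\<^sub>1 P\<^sub>2 P\<^sub>3 P\<^sub>4"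
proof -
  obtain A B C D where ABCD: "{A, B, C, D} \<subseteq> CP2" "distinct [A, B, C, D]"
      "\<not> collinear_points A B C" "\<not> collinear_points A B D"
      "\<not> collinear_points A C D" "\<not> collinear_points B C D"
    and F: "F = {\<Gamma> \<in> conics. {A, B, C, D} \<subseteq> zero_set \<Gamma>}"
    using assms(1) unfolding nondegenerate_pencil_def by blast
  obtain e1 e2 e3 X1 X2 X3 where X: "frame e1 e2 e3 X1 X2 X3"
    and base: "A = vec.span {frame.mk e1 e2 e3 (-1) 1 1}" "B = vec.span {frame.mk e1 e2 e3 1 (-1) 1}"
    "C = vec.span {frame.mk e1 e2 e3 1 1 (-1)}" "D = vec.span {frame.mk e1 e2 e3 1 1 1}"
    by (rule adapted_frame[OF ABCD]) blast
  interpret frame e1 e2 e3 X1 X2 X3 by (rule X)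
  have F: "F = diag_pencil" unfolding F base by (rule conics_through_base_points)
  have ed: "vec.span {e1} \<notin> d" "vec.span {e2} \<notin> d" "vec.span {e3} \<notin> d"
    using frame_double_points assms(2,6-8) unfolding F by auto
  obtain \<alpha> \<beta> \<gamma> where d: "\<And>x. vec.span {x} \<in> d \<longleftrightarrow> x \<noteq> 0 \<and> lf \<alpha> \<beta> \<gamma> x = 0" "d \<subseteq> CP2"
    by (rule line_imp_lf[OF assms(5)]) blast
  \<comment> \<open>The form of the line takes the values \<open>\<alpha>\<close>,
    \<open>\<beta>\<close>, \<open>\<gamma>\<close> at \<open>e1\<close>, \<open>e2\<close>,
    \<open>e3\<close>. These span double points, which are not on \<open>d\<close>, so all three
    values are non-zero.\<close>
  interpret frame_line e1 e2 e3 X1 X2 X3 \<alpha> \<beta> \<gamma>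
    by unfold_locales (use ed in \<open>auto simp: d lf_def eq_iff_X\<close>)
  have d: "d = dline" using d unfolding dline_def by (fastforce simp: mem_CP2_iff)
  \<comment> \<open>Turns distinctness of the conics into the determinant conditions of
    \<open>cross_ratio_poles\<close>.\<close>
  have det: "a * b' - a' * b \<noteq> 0"
    if "(a, a') \<noteq> (0, 0)" "(b, b') \<noteq> (0, 0)" "fn.span {diag a a'} \<noteq> fn.span {diag b b'}" for a a' b b'
    using fn.span_neq_iff_det[OF independent_diag that(1,2)] that(3) unfolding diag_eq[symmetric] by blast
  have ex: "\<exists>a b. (a, b) \<noteq> (0, 0) \<and> \<Gamma> = fn.span {diag a b}" if "\<Gamma> \<in> F" for \<Gamma>
    using that unfolding F diag_pencil_def by blast
  obtain a a' where a: "(a, a') \<noteq> (0, 0)" "\<Gamma>\<^sub>1 = fn.span {diag a a'}"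
    using assms(3) ex[of "\<Gamma>\<^sub>1"] by auto
  obtain b b' where b: "(b, b') \<noteq> (0, 0)" "\<Gamma>\<^sub>2 = fn.span {diag b b'}"
    using assms(3) ex[of "\<Gamma>\<^sub>2"] by auto
  obtain c c' where c: "(c, c') \<noteq> (0, 0)" "\<Gamma>\<^sub>3 = fn.span {diag c c'}"
    using assms(3) ex[of "\<Gamma>\<^sub>3"] by auto
  obtain m m' where m: "(m, m') \<noteq> (0, 0)" "\<Gamma>\<^sub>4 = fn.span {diag m m'}"
    using assms(3) ex[of "\<Gamma>\<^sub>4"] by auto
  note nz = a(1) b(1) c(1) m(1) and \<Gamma> = a(2) b(2) c(2) m(2)
  have ne: "\<Gamma>\<^sub>1 \<noteq> \<Gamma>\<^sub>2" "\<Gamma>\<^sub>1 \<noteq> \<Gamma>\<^sub>3" "\<Gamma>\<^sub>2 \<noteq> \<Gamma>\<^sub>3" "\<Gamma>\<^sub>1 \<noteq> \<Gamma>\<^sub>4" "\<Gamma>\<^sub>2 \<noteq> \<Gamma>\<^sub>4" "\<Gamma>\<^sub>3 \<noteq> \<Gamma>\<^sub>4"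
    using assms(4) by auto
  show ?thesis
    unfolding assms(9-13) F d \<Gamma>
    by (rule cross_ratio_poles; rule det) (use nz ne in \<open>simp_all add: \<Gamma>\<close>)
qed

end
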